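(* Let $T$ be an ergodic automorphism of $\mathbb T^2=\mathbb R^2/\mathbb Z^2$ given by $M_T=\begin{pmatrix} a & b \\ c & d \end{pmatrix}\in GL(2,\mathbb Z)$ with $r=\operatorname{Tr}M_T>0$, $\sigma=\det M_T$. I. $T$ admits a bijective arithmetic coding if and only if $M_T$ is algebraically conjugate to the companion matrix $C_{r,\sigma}=\begin{pmatrix} r & 1 \\ -\sigma & 0 \end{pmatrix}$. II. $M_T$ is algebraically conjugate to $C_{r,\sigma}$ if and only if one of the equations $f_T(x,y)=\pm1$ is solvable in $\mathbb Z$. Any matrix $B=\begin{pmatrix} x & y \\ z & t \end{pmatrix}\in GL(2,\mathbb Z)$ such that $BM_TB^{-1}=C_{r,\sigma}$ is parametrized by a solution of this Diophantine equation; namely, $(x,y)$ is always a solution of $f_T(x,y)=\pm1$, and $$(z,t)=-\det M_T\cdot(x,y)M_T^{-1}.$$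
   Context: For $2$-torus automorphisms ergodicity is equivalent to hyperbolicity. Put $D=r^2-4\sigma$, $\lambda=\frac{r+\sqrt D}2>1$. The form associated with $T$ is $f_T(x,y)=bx^2-(a-d)xy-cy^2$. Matrices $M_1,M_2$ are algebraically conjugate if $BM_1B^{-1}=M_2$ for some $B\in GL(2,\mathbb Z)$. Homoclinic points: $x\in\mathbb T^2$ is homoclinic (to zero) for $T$ if $T^nx\to0$ as $n\to\pm\infty$. It is written in coordinates of $\mathbb R^2$ as its unique lift $\mathbf t\in\mathbb R^2$ on the $\lambda$-eigenline of $M_T$. Symbolic compactum $\mathfrak X$: if $\sigma=-1$, the set of two-sided sequences with $\varepsilon_n\in\{0,\dots,r\}$ and $\varepsilon_n=r\Rightarrow\varepsilon_{n+1}=0$; if $\sigma=+1$, the set of two-sided sequences with $\varepsilon_n\in\{0,\dots,r-1\}$ containing no block $(r-1)(r-2)^j(r-1)$, $j\ge0$. An arithmetic coding of $T$ is a map $\varphi_{\mathbf t}:\mathfrak X\to\mathbb T^2$, $\varphi_{\mathbf t}(\varepsilon)=\lim_{N\to\infty}\big(\sum_{n=-N}^N\varepsilon_n\lambda^{-n}\big)\mathbf t\bmod\mathbb Z^2$, where $\mathbf t\neq0$ is a homoclinic point of $T$ in coordinates of $\mathbb R^2$ (the limit exists and the map is onto). It is bijective if Lebesgue-almost every point of $\mathbb T^2$ has exactly one preimage. *)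

theory Defs
  imports "HOL-Analysis.Analysis"
begin

definition lattice_equiv :: "real^2 \<Rightarrow> real^2 \<Rightarrow> bool" where
  "lattice_equiv x y \<longleftrightarrow> (\<forall>i. x $ i - y $ i \<in> \<int>)"

lemma equivp_lattice_equiv: "equivp lattice_equiv"
proof (rule equivpI)
  show "reflp lattice_equiv"
    by (auto simp: reflp_def lattice_equiv_def)
  show "symp lattice_equiv"
    by (auto simp: symp_def lattice_equiv_def) (metis Ints_minus minus_diff_eq)
  show "transp lattice_equiv"
  proof (rule transpI)
    fix x y z assume a: "lattice_equiv x y" "lattice_equiv y z"
    have "x $ i - z $ i \<in> \<int>" for i
      using Ints_add[of "x $ i - y $ i" "y $ i - z $ i"] a by (simp add: lattice_equiv_def)
    thus "lattice_equiv x z" by (simp add: lattice_equiv_def)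
  qed
qed

quotient_type torus = "real^2" / lattice_equiv
  morphisms torus_rep torus_proj
  by (rule equivp_lattice_equiv)

instantiation torus :: topological_space
begin

definition open_torus :: "torus set \<Rightarrow> bool" where
  "open_torus U \<longleftrightarrow> open (torus_proj -` U)"

instance
proof
  show "open (UNIV :: torus set)" by (simp add: open_torus_def)
  show "open (S \<inter> T)" if "open S" "open T" for S T :: "torus set"
    using that by (simp add: open_torus_def open_Int)
  show "open (\<Union>K)" if "\<forall>S\<in>K. open S" for K :: "torus set set"
    using that by (auto simp: open_torus_def vimage_Union)
qed

end

lemma cis_2pi_eq_iff: "cis (2 * pi * u) = cis (2 * pi * v) \<longleftrightarrow> u - v \<in> \<int>"
proof -
  have "cis (2 * pi * u) = cis (2 * pi * v) \<longleftrightarrow>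
      (\<exists>n::int. \<i> * complex_of_real (2 * pi * u)
        = \<i> * complex_of_real (2 * pi * v) + (of_int (2 * n) * pi) * \<i>)"
    by (simp only: cis_conv_exp exp_eq)
  also have "\<dots> \<longleftrightarrow> (\<exists>n::int. u = v + of_int n)"
  proof (intro ex_cong1)
    fix n :: int
    have "\<i> * complex_of_real (2 * pi * u)
          = \<i> * complex_of_real (2 * pi * v) + (of_int (2 * n) * pi) * \<i> \<longleftrightarrow>
        2 * pi * u = 2 * pi * v + 2 * n * pi"
      by (simp add: complex_eq_iff)
    also have "\<dots> \<longleftrightarrow> 2 * pi * u = 2 * pi * (v + n)"
      by (simp add: algebra_simps)
    also have "\<dots> \<longleftrightarrow> u = v + n" by simp
    finally show "\<i> * complex_of_real (2 * pi * u)
          = \<i> * complex_of_real (2 * pi * v) + (of_int (2 * n) * pi) * \<i> \<longleftrightarrow> u = v + of_int n" .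
  qed
  also have "\<dots> \<longleftrightarrow> u - v \<in> \<int>"
    by (auto simp: Ints_def image_iff) (metis add.commute diff_add_cancel)+
  finally show ?thesis .
qed

lift_definition torus_cis :: "torus \<Rightarrow> complex \<times> complex" is
  "\<lambda>x. (cis (2 * pi * x $ 1), cis (2 * pi * x $ 2))"
  by (simp add: lattice_equiv_def cis_2pi_eq_iff)

lemma inj_torus_cis: "torus_cis p = torus_cis q \<Longrightarrow> p = q"
  by transfer (auto simp: lattice_equiv_def cis_2pi_eq_iff forall_2)

lemma continuous_torus_proj: "continuous_on UNIV torus_proj"
  by (simp add: continuous_on_open_vimage open_torus_def)

lemma continuous_torus_cis: "continuous_on UNIV torus_cis"
proof -
  have "open (torus_cis -` V)" if "open V" for V
  proof -
    have "torus_proj -` (torus_cis -` V)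
        = (\<lambda>x. (cis (2 * pi * x $ 1), cis (2 * pi * x $ 2))) -` V"
      by (auto simp: torus_cis.abs_eq)
    moreover have "open \<dots>"
      by (intro open_vimage that continuous_intros)
    ultimately show ?thesis by (simp add: open_torus_def)
  qed
  thus ?thesis by (simp add: continuous_on_open_vimage)
qed

instance torus :: t2_space
proof
  fix p q :: torus assume "p \<noteq> q"
  hence "torus_cis p \<noteq> torus_cis q" using inj_torus_cis by blast
  then obtain U V where UV: "open U" "open V" "torus_cis p \<in> U" "torus_cis q \<in> V" "U \<inter> V = {}"
    using hausdorff by metis
  show "\<exists>U V. open U \<and> open V \<and> p \<in> U \<and> q \<in> V \<and> U \<inter> V = {}"
    using UV continuous_torus_cis
    by (intro exI[of _ "torus_cis -` U"] exI[of _ "torus_cis -` V"])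
       (auto simp: open_vimage)
qed

text \<open>Normalised Lebesgue measure on the torus: the image of Lebesgue measure on the fundamental
  domain \<open>[0,1)\<^sup>2\<close>.\<close>
definition torus_lebesgue :: "torus measure" where
  "torus_lebesgue = distr (restrict_space lborel {x. \<forall>i. 0 \<le> x $ i \<and> x $ i < 1}) borel torus_proj"

definition real_matrix :: "int^2^2 \<Rightarrow> real^2^2" where
  "real_matrix M = (\<chi> i j. real_of_int (M $ i $ j))"

lemma lattice_equiv_real_matrix:
  assumes "lattice_equiv x y"
  shows "lattice_equiv (real_matrix M *v x) (real_matrix M *v y)"
proof -
  have "(real_matrix M *v x) $ i - (real_matrix M *v y) $ i
      = (\<Sum>j\<in>UNIV. of_int (M $ i $ j) * (x $ j - y $ j))" for i
    by (simp add: matrix_vector_mult_def real_matrix_def sum_subtractf[symmetric] algebra_simps)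
  moreover have "(\<Sum>j\<in>UNIV. of_int (M $ i $ j) * (x $ j - y $ j)) \<in> \<int>" for i
    using assms by (intro Ints_sum Ints_mult) (auto simp: lattice_equiv_def)
  ultimately show ?thesis by (simp add: lattice_equiv_def)
qed

lift_definition torus_map :: "int^2^2 \<Rightarrow> torus \<Rightarrow> torus" is
  "\<lambda>M x. real_matrix M *v x"
  by (rule lattice_equiv_real_matrix)

definition ergodic :: "'a measure \<Rightarrow> ('a \<Rightarrow> 'a) \<Rightarrow> bool" where
  "ergodic \<mu> T \<longleftrightarrow> T \<in> measurable \<mu> \<mu> \<and> distr \<mu> \<mu> T = \<mu> \<and>
    (\<forall>A\<in>sets \<mu>. T -` A \<inter> space \<mu> = A \<longrightarrow>
       emeasure \<mu> A = 0 \<or> emeasure \<mu> (space \<mu> - A) = 0)"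

definition dominant_eigenvalue :: "int^2^2 \<Rightarrow> real" where
  "dominant_eigenvalue M =
     (let r = real_of_int (trace M); D = r\<^sup>2 - 4 * real_of_int (det M) in (r + sqrt D) / 2)"

definition homoclinic :: "int^2^2 \<Rightarrow> torus \<Rightarrow> bool" where
  "homoclinic M p \<longleftrightarrow>
     (\<lambda>n. (torus_map M ^^ n) p) \<longlonglongrightarrow> torus_proj 0 \<and>
     (\<lambda>n. (inv (torus_map M) ^^ n) p) \<longlonglongrightarrow> torus_proj 0"

text \<open>\<open>t\<close> is the coordinate vector of a homoclinic point: its lift on the expanding eigenline.\<close>
definition homoclinic_coords :: "int^2^2 \<Rightarrow> real^2 \<Rightarrow> bool" where
  "homoclinic_coords M t \<longleftrightarrow>
     homoclinic M (torus_proj t) \<and> real_matrix M *v t = dominant_eigenvalue M *\<^sub>R t"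

text \<open>Only the values \<open>\<sigma> = -1\<close> and \<open>\<sigma> = 1\<close> are meaningful.\<close>
definition symbolic_compactum :: "int \<Rightarrow> int \<Rightarrow> (int \<Rightarrow> int) set" where
  "symbolic_compactum r \<sigma> =
     (if \<sigma> = -1 then
        {\<epsilon>. (\<forall>n. \<epsilon> n \<in> {0..r}) \<and> (\<forall>n. \<epsilon> n = r \<longrightarrow> \<epsilon> (n + 1) = 0)}
      else
        {\<epsilon>. (\<forall>n. \<epsilon> n \<in> {0..r - 1}) \<and>
            \<not> (\<exists>n. \<exists>j::nat. \<epsilon> n = r - 1 \<and> (\<forall>i\<in>{1..int j}. \<epsilon> (n + i) = r - 2) \<and>
                 \<epsilon> (n + int j + 1) = r - 1)})"

definition arithmetic_coding :: "int^2^2 \<Rightarrow> ((int \<Rightarrow> int) \<Rightarrow> torus) \<Rightarrow> bool" where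
  "arithmetic_coding M \<phi> \<longleftrightarrow>
     (\<exists>t. t \<noteq> 0 \<and> homoclinic_coords M t \<and>
       (\<forall>\<epsilon>\<in>symbolic_compactum (trace M) (det M).
          (\<lambda>N. torus_proj
             ((\<Sum>n=-int N..int N. real_of_int (\<epsilon> n) * dominant_eigenvalue M powi (-n)) *\<^sub>R t))
          \<longlonglongrightarrow> \<phi> \<epsilon>))"

text \<open>A coding is a map on the symbolic compactum; the values of \<open>\<phi>\<close> outside it are ignored.\<close>
definition bijective_coding :: "int^2^2 \<Rightarrow> ((int \<Rightarrow> int) \<Rightarrow> torus) \<Rightarrow> bool" where
  "bijective_coding M \<phi> \<longleftrightarrow>
     (AE p in torus_lebesgue. \<exists>!\<epsilon>. \<epsilon> \<in> symbolic_compactum (trace M) (det M) \<and> \<phi> \<epsilon> = p)"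

definition algebraically_conjugate :: "int^2^2 \<Rightarrow> int^2^2 \<Rightarrow> bool" where
  "algebraically_conjugate M\<^sub>1 M\<^sub>2 \<longleftrightarrow> (\<exists>B. invertible B \<and> B ** M\<^sub>1 ** matrix_inv B = M\<^sub>2)"

definition companion_matrix :: "int \<Rightarrow> int \<Rightarrow> int^2^2" where
  "companion_matrix r \<sigma> = vector [vector [r, 1], vector [-\<sigma>, 0]]"

definition assoc_form :: "int^2^2 \<Rightarrow> int \<Rightarrow> int \<Rightarrow> int" where
  "assoc_form M x y =
     (let a = M $ 1 $ 1; b = M $ 1 $ 2; c = M $ 2 $ 1; d = M $ 2 $ 2
      in b * x\<^sup>2 - (a - d) * x * y - c * y\<^sup>2)"

end

theory Submission
  imports Defs
begin

text \<open>
  Write \<open>\<beta>\<close> for the dominant eigenvalue, \<open>\<mu> = r - \<beta>\<close> for its conjugate, and split an integer vector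
  as \<open>m = t + s\<close> along the expanding and contracting eigenlines. The homoclinic coordinates are
  exactly the vectors \<open>t\<close>, and since \<open>\<beta>\<^sup>n t + \<mu>\<^sup>n s = M\<^sup>n m\<close> is integral, the coding by \<open>t\<close> sends
  \<open>\<epsilon>\<close> to the class of \<open>A t - B s\<close> with \<open>A = \<Sum>\<^sub>n\<^sub>\<ge>\<^sub>0 \<epsilon>\<^sub>n \<beta>\<^sup>-\<^sup>n\<close> and \<open>B = \<Sum>\<^sub>n\<^sub>\<ge>\<^sub>1 \<epsilon>\<^sub>-\<^sub>n \<mu>\<^sup>n\<close>.

  Modulo the lattice \<open>\<Lambda>\<close> generated by \<open>m\<close> and \<open>M m\<close> this map is onto (expand greedily, shift, and
  use compactness) and almost everywhere injective: the points \<open>(A, -B)\<close> fill a union of two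
  rectangles whose interior is disjoint from its translates by the conjugate pairs of
  \<open>\<int>[\<beta>]\<close>, so two codes of a point all of whose shifts avoid the boundary have the same shifts.
  Hence a point of the torus has exactly one code almost everywhere if and only if
  \<open>\<Lambda> = \<int>\<^sup>2\<close>, that is, if and only if the determinant of \<open>m\<close> and \<open>M m\<close>, which is the value of the
  associated form at a rotation of \<open>m\<close> up to sign, is \<open>1\<close> or \<open>-1\<close>.
\<close>

subsection \<open>Quadratic units\<close>

text \<open>The sign cases are the hyperbolic ones of positive trace: with determinant 1, trace 1
  puts both roots on the unit circle and trace 2 gives a double root 1.\<close>

locale quadratic_unit =
  fixes r \<sigma> :: int and \<beta> \<mu> :: real
  assumes beta_gt_1: "\<beta> > 1"
    and beta_plus_mu: "\<beta> + \<mu> = r"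
    and beta_times_mu: "\<beta> * \<mu> = \<sigma>"
    and sign_cases: "\<sigma> = -1 \<and> r \<ge> 1 \<or> \<sigma> = 1 \<and> r \<ge> 3"
begin

abbreviation X :: "(int \<Rightarrow> int) set" where
  "X \<equiv> symbolic_compactum r \<sigma>"

definition future :: "(int \<Rightarrow> int) \<Rightarrow> real" where
  "future \<epsilon> = (\<Sum>n. real_of_int (\<epsilon> (int n)) * (1/\<beta>)^n)"

definition past :: "(int \<Rightarrow> int) \<Rightarrow> real" where
  "past \<epsilon> = (\<Sum>k. real_of_int (\<epsilon> (-1 - int k)) * \<mu>^Suc k)"

lemma beta_nz [simp]: "\<beta> \<noteq> 0"
  using beta_gt_1 by simp

lemma sigma_sq: "\<sigma> * \<sigma> = 1"
  using sign_cases by auto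

lemma mu_eq: "\<mu> = \<sigma> / \<beta>"
  using beta_times_mu by (simp add: field_simps)

lemma abs_mu: "\<bar>\<mu>\<bar> = 1 / \<beta>"
  using sign_cases beta_gt_1 by (auto simp: mu_eq)

lemma mu_nz [simp]: "\<mu> \<noteq> 0"
  using sign_cases by (auto simp: mu_eq)

lemma beta_sq: "\<beta> * \<beta> = r * \<beta> - \<sigma>"
  using beta_plus_mu beta_times_mu by (metis add_diff_cancel_right' distrib_left mult.commute)

lemma mu_less_beta: "\<mu> < \<beta>"
  using beta_gt_1 abs_mu by (smt (verit) divide_less_eq_1)

text \<open>As \<open>\<sigma>\<close> is its own inverse, the inverse of each root is
  \<open>\<sigma>\<close> times the other root. This keeps division by the roots inside
  \<int>[\<beta>].\<close>

lemma inverse_beta: "1 / \<beta> = \<sigma> * (r - \<beta>)" and inverse_mu: "1 / \<mu> = \<sigma> * (r - \<mu>)"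
proof -
  have "real_of_int \<sigma> * \<sigma> = 1"
    using sigma_sq by (metis of_int_1 of_int_mult)
  moreover have "r - \<beta> = \<mu>" "r - \<mu> = \<beta>"
    using beta_plus_mu by linarith+
  ultimately have "\<sigma> * (r - \<beta>) * \<beta> = 1" "\<sigma> * (r - \<mu>) * \<mu> = 1"
    using beta_times_mu by (metis mult.assoc mult.commute)+
  thus "1 / \<beta> = \<sigma> * (r - \<beta>)" "1 / \<mu> = \<sigma> * (r - \<mu>)"
    by (metis beta_nz nonzero_eq_divide_eq, metis mu_nz nonzero_eq_divide_eq)
qed

lemma X_minus_iff:
  assumes "\<sigma> = -1"
  shows "\<epsilon> \<in> X \<longleftrightarrow> (\<forall>n. 0 \<le> \<epsilon> n \<and> \<epsilon> n \<le> r) \<and> (\<forall>n. \<epsilon> n = r \<longrightarrow> \<epsilon> (n + 1) = 0)"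
  using assms by (simp add: symbolic_compactum_def)

lemma X_plus_iff:
  assumes "\<sigma> = 1"
  shows "\<epsilon> \<in> X \<longleftrightarrow> (\<forall>n. 0 \<le> \<epsilon> n \<and> \<epsilon> n \<le> r - 1) \<and>
    (\<forall>n. \<forall>j::nat. \<not> (\<epsilon> n = r - 1 \<and> (\<forall>i\<in>{1..int j}. \<epsilon> (n + i) = r - 2) \<and> \<epsilon> (n + int j + 1) = r - 1))"
  using assms by (simp add: symbolic_compactum_def)

lemma digit_bounds: "\<epsilon> \<in> X \<Longrightarrow> 0 \<le> \<epsilon> n \<and> \<epsilon> n \<le> r"
  by (fastforce simp: symbolic_compactum_def less_imp_le split: if_splits)

lemma summable_geometric_beta: "summable (\<lambda>n. real_of_int r * (1/\<beta>)^n)"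
  using beta_gt_1 by (intro summable_mult summable_geometric) auto

lemma future_term_bound:
  assumes "\<epsilon> \<in> X" shows "norm (real_of_int (\<epsilon> (int n)) * (1/\<beta>)^n) \<le> r * (1/\<beta>)^n"
  using digit_bounds[OF assms, of "int n"] beta_gt_1
  by (auto simp: abs_mult intro!: mult_right_mono divide_right_mono)

lemma past_term_bound:
  assumes "\<epsilon> \<in> X" shows "norm (real_of_int (\<epsilon> (-1 - int k)) * \<mu>^Suc k) \<le> r * (1/\<beta>)^k"
proof -
  have "\<bar>\<mu>\<bar> ^ Suc k \<le> (1/\<beta>) ^ k"
    using beta_gt_1 unfolding abs_mu by (intro power_decreasing) auto
  thus ?thesis
    using digit_bounds[OF assms, of "-1 - int k"]
    by (simp add: abs_mult power_abs[symmetric] del: power_Suc) (intro mult_mono, auto)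
qed

lemma summable_future: "\<epsilon> \<in> X \<Longrightarrow> summable (\<lambda>n. real_of_int (\<epsilon> (int n)) * (1/\<beta>)^n)"
  by (rule summable_comparison_test'[OF summable_geometric_beta, of 0]) (rule future_term_bound)

lemma summable_past: "\<epsilon> \<in> X \<Longrightarrow> summable (\<lambda>k. real_of_int (\<epsilon> (-1 - int k)) * \<mu>^Suc k)"
  by (rule summable_comparison_test'[OF summable_geometric_beta, of 0]) (rule past_term_bound)

subsection \<open>The domain of the natural extension\<close>

text \<open>
  For \<open>\<sigma> = -1\<close> the pairs (future, past) lie in \<open>[0, \<beta>] \<times> [-1 + 1/\<beta>, 1/\<beta>] \<union> [0, 1] \<times> [-1, -1 + 1/\<beta>]\<close>,
  the second rectangle accounting for a last past digit \<open>r\<close>; for \<open>\<sigma> = 1\<close> they lie in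
  \<open>[0, \<beta>] \<times> [0, 1 - 1/\<beta>] \<union> [0, \<beta> - 1] \<times> [1 - 1/\<beta>, 1]\<close>, the second rectangle accounting for a
  past ending in \<open>(r-1)(r-2)\<^sup>j\<close>. In both cases the area is \<open>\<bar>\<beta> - \<mu>\<bar>\<close>, the covolume of \<open>\<int>[\<beta>]\<close>.
\<close>

lemma future_bounds_minus:
  fixes s :: "nat \<Rightarrow> int"
  assumes "\<sigma> = -1" "\<And>n. 0 \<le> s n \<and> s n \<le> r" "\<And>n. s n = r \<Longrightarrow> s (Suc n) = 0"
  shows "(\<Sum>n<N. s n * (1/\<beta>)^n) \<le> \<beta> \<and> (s 0 = 0 \<longrightarrow> (\<Sum>n<N. s n * (1/\<beta>)^n) \<le> 1)"
  using assms(2,3)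
proof (induction N arbitrary: s)
  case 0
  then show ?case using beta_gt_1 by simp
next
  case (Suc N)
  define S where "S = (\<Sum>n<N. s (Suc n) * (1/\<beta>)^n)"
  have IH: "S \<le> \<beta>" "s 1 = 0 \<Longrightarrow> S \<le> 1"
    using Suc.IH[of "\<lambda>n. s (Suc n)"] Suc.prems unfolding S_def by auto
  have eq: "(\<Sum>n<Suc N. s n * (1/\<beta>)^n) = s 0 + S / \<beta>"
    by (simp add: sum.lessThan_Suc_shift S_def sum_divide_distrib del: sum.lessThan_Suc)
  have inv: "1 / \<beta> = \<beta> - r"
    using inverse_beta assms(1) by simp
  have S1: "S / \<beta> \<le> 1" using IH(1) beta_gt_1 by simp
  \<comment> \<open>A digit \<open>r\<close> is followed by 0, so the tail is at most 1, and
    \<open>r + 1/\<beta> = \<beta>\<close>: the second bound is what lets the induction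
    close.\<close>
  have S2: "S / \<beta> \<le> \<beta> - r" if "s 0 = r"
  proof -
    have "S / \<beta> \<le> 1 / \<beta>"
      using IH(2) that Suc.prems(2)[of 0] beta_gt_1 by (intro divide_right_mono) auto
    thus ?thesis using inv by simp
  qed
  have "real_of_int (s 0) \<le> r - 1" if "s 0 \<noteq> r"
    using Suc.prems(1)[of 0] that by linarith
  moreover have "\<beta> > r" using inv beta_gt_1 by (smt (verit) divide_pos_pos)
  ultimately show ?case unfolding eq using S1 S2 by fastforce
qed

text \<open>The sums are the past with one factor \<open>\<mu>\<close> removed. As
  \<open>\<mu>\<close> is negative, splitting off the digit nearest the origin leaves
  \<open>s 0 - S / \<beta>\<close>, so each bound follows from the opposite bound for the tail,
  again by \<open>r + 1/\<beta> = \<beta>\<close>.\<close>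

lemma past_bounds_minus:
  fixes s :: "nat \<Rightarrow> int"
  assumes "\<sigma> = -1" "\<And>n. 0 \<le> s n \<and> s n \<le> r" "\<And>n. s (Suc n) = r \<Longrightarrow> s n = 0"
  shows "-1 \<le> (\<Sum>n<N. s n * \<mu>^n) \<and> (\<Sum>n<N. s n * \<mu>^n) \<le> \<beta> \<and>
         (s 0 \<noteq> r \<longrightarrow> (\<Sum>n<N. s n * \<mu>^n) \<le> \<beta> - 1)"
  using assms(2,3)
proof (induction N arbitrary: s)
  case 0
  then show ?case using beta_gt_1 by simp
next
  case (Suc N)
  define S where "S = (\<Sum>n<N. s (Suc n) * \<mu>^n)"
  have IH: "-1 \<le> S" "S \<le> \<beta>" "s 1 \<noteq> r \<Longrightarrow> S \<le> \<beta> - 1"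
    using Suc.IH[of "\<lambda>n. s (Suc n)", OF Suc.prems(1) Suc.prems(2)] unfolding S_def by simp_all
  have mu: "\<mu> = - (1 / \<beta>)" using mu_eq assms(1) by simp
  have eq: "(\<Sum>n<Suc N. s n * \<mu>^n) = s 0 - S / \<beta>"
    by (simp add: sum.lessThan_Suc_shift S_def sum_divide_distrib mu sum_negf del: sum.lessThan_Suc)
  have inv: "1 / \<beta> = \<beta> - r"
    using inverse_beta assms(1) by simp
  have S1: "S / \<beta> \<le> 1" using IH(2) beta_gt_1 by simp
  have S2: "S / \<beta> \<ge> - (\<beta> - r)"
    using divide_right_mono[OF IH(1), of \<beta>] beta_gt_1 inv by simp
  have "s 0 \<le> r" "s 0 = 0 \<or> s 0 \<ge> 1" "s 0 \<noteq> r \<Longrightarrow> s 0 \<le> r - 1" using Suc.prems(1)[of 0] by auto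
  hence "real_of_int (s 0) \<le> r" "real_of_int (s 0) = 0 \<or> real_of_int (s 0) \<ge> 1"
    "s 0 \<noteq> r \<Longrightarrow> real_of_int (s 0) \<le> r - 1" by linarith+
  thus ?case unfolding eq using S1 S2 by fastforce
qed

text \<open>A forbidden block \<open>(r-1)(r-2)^j(r-1)\<close> without its first digit. The block is
  a palindrome, so the same predicate serves the future and the past read backwards.\<close>

definition leads_high :: "(nat \<Rightarrow> int) \<Rightarrow> bool" where
  "leads_high s \<longleftrightarrow> (\<exists>j. (\<forall>i<j. s i = r - 2) \<and> s j = r - 1)"

lemma leads_high_Suc:
  "leads_high s \<longleftrightarrow> s 0 = r - 1 \<or> s 0 = r - 2 \<and> leads_high (\<lambda>n. s (Suc n))"
proof
  assume "leads_high s"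
  then obtain j where j: "\<forall>i<j. s i = r - 2" "s j = r - 1" by (auto simp: leads_high_def)
  show "s 0 = r - 1 \<or> s 0 = r - 2 \<and> leads_high (\<lambda>n. s (Suc n))"
    using j by (cases j) (auto simp: leads_high_def)
next
  assume "s 0 = r - 1 \<or> s 0 = r - 2 \<and> leads_high (\<lambda>n. s (Suc n))"
  thus "leads_high s"
  proof
    assume "s 0 = r - 1"
    thus ?thesis by (auto simp: leads_high_def)
  next
    assume *: "s 0 = r - 2 \<and> leads_high (\<lambda>n. s (Suc n))"
    then obtain j where "\<forall>i<j. s (Suc i) = r - 2" "s (Suc j) = r - 1" by (auto simp: leads_high_def)
    with * show ?thesis unfolding leads_high_def
      by (intro exI[of _ "Suc j"]) (auto simp: less_Suc_eq_0_disj)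
  qed
qed

text \<open>Both bounds are proved together. A first digit \<open>r-1\<close> forces a tail that is
  not high, and one \<open>r-2\<close> in a sequence that is not high does so too; in these cases
  \<open>1/\<beta> = r - \<beta>\<close> turns the tail bound \<open>\<beta> - 1\<close> into
  exactly \<open>\<beta>\<close> and \<open>\<beta> - 1\<close>. Smaller digits leave room because
  \<open>r - \<beta> < 1\<close>.\<close>

lemma bounds_plus:
  fixes s :: "nat \<Rightarrow> int"
  assumes "\<sigma> = 1" "\<And>n. 0 \<le> s n \<and> s n \<le> r - 1"
    and "\<And>n. s n = r - 1 \<Longrightarrow> \<not> leads_high (\<lambda>i. s (Suc (n + i)))"
  shows "(\<Sum>n<N. s n * (1/\<beta>)^n) \<le> \<beta> \<and>
         (\<not> leads_high s \<longrightarrow> (\<Sum>n<N. s n * (1/\<beta>)^n) \<le> \<beta> - 1)"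
  using assms(2,3)
proof (induction N arbitrary: s)
  case 0
  then show ?case using beta_gt_1 by simp
next
  case (Suc N)
  define S where "S = (\<Sum>n<N. s (Suc n) * (1/\<beta>)^n)"
  have IH: "S \<le> \<beta>" "\<not> leads_high (\<lambda>n. s (Suc n)) \<Longrightarrow> S \<le> \<beta> - 1"
    using Suc.IH[of "\<lambda>n. s (Suc n)"] Suc.prems(1) Suc.prems(2)[of "Suc _"] unfolding S_def by auto
  have eq: "(\<Sum>n<Suc N. s n * (1/\<beta>)^n) = s 0 + S / \<beta>"
    by (simp add: sum.lessThan_Suc_shift S_def sum_divide_distrib del: sum.lessThan_Suc)
  have inv: "1 / \<beta> = r - \<beta>"
    using inverse_beta assms(1) by simp
  have S1: "S / \<beta> \<le> 1" using IH(1) beta_gt_1 by simp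
  have S2: "S / \<beta> \<le> 1 - (r - \<beta>)" if "\<not> leads_high (\<lambda>n. s (Suc n))"
    using divide_right_mono[OF IH(2)[OF that], of \<beta>] beta_gt_1 inv by (simp add: diff_divide_distrib)
  have small: "real_of_int (s 0) \<le> r - 2" if "s 0 \<noteq> r - 1"
    using Suc.prems(1)[of 0] that by linarith
  have smaller: "real_of_int (s 0) \<le> r - 3" if "s 0 \<noteq> r - 1" "s 0 \<noteq> r - 2"
    using Suc.prems(1)[of 0] that by linarith
  have big: "\<not> leads_high (\<lambda>n. s (Suc n))" if "s 0 = r - 1"
    using Suc.prems(2)[of 0] that by simp
  have "r - \<beta> < 1" using inv beta_gt_1 by (metis divide_less_eq_1_pos less_trans zero_less_one)
  have "s 0 + S / \<beta> \<le> \<beta>"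
    using S1 S2 small big \<open>r - \<beta> < 1\<close> by (cases "s 0 = r - 1") auto
  moreover have "s 0 + S / \<beta> \<le> \<beta> - 1" if "\<not> leads_high s"
  proof -
    have "s 0 \<noteq> r - 1" "s 0 = r - 2 \<Longrightarrow> \<not> leads_high (\<lambda>n. s (Suc n))"
      using that leads_high_Suc by blast+
    thus ?thesis using S1 S2 smaller \<open>r - \<beta> < 1\<close> by (cases "s 0 = r - 2") auto
  qed
  ultimately show ?case unfolding eq by blast
qed

lemma past_eq: assumes "\<epsilon> \<in> X"
  shows "summable (\<lambda>k. real_of_int (\<epsilon> (-1 - int k)) * \<mu>^k)"
    and "past \<epsilon> = \<mu> * (\<Sum>k. real_of_int (\<epsilon> (-1 - int k)) * \<mu>^k)"
proof -
  show sm: "summable (\<lambda>k. real_of_int (\<epsilon> (-1 - int k)) * \<mu>^k)"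
    using summable_mult[OF summable_past[OF assms], of "1/\<mu>"] by (simp add: field_simps)
  show "past \<epsilon> = \<mu> * (\<Sum>k. real_of_int (\<epsilon> (-1 - int k)) * \<mu>^k)"
    unfolding past_def using sm by (subst suminf_mult[symmetric]) (auto simp: mult_ac)
qed

lemma future_nonneg: "\<epsilon> \<in> X \<Longrightarrow> 0 \<le> future \<epsilon>"
  unfolding future_def using digit_bounds beta_gt_1 by (intro suminf_nonneg summable_future) auto

lemma tile_minus:
  assumes \<sigma>: "\<sigma> = -1" and \<epsilon>: "\<epsilon> \<in> X"
  shows "0 \<le> future \<epsilon>" "future \<epsilon> \<le> \<beta>" "-1 \<le> past \<epsilon>" "past \<epsilon> \<le> 1/\<beta>"
    "past \<epsilon> \<ge> -1 + 1/\<beta> \<or> future \<epsilon> \<le> 1"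
proof -
  show "0 \<le> future \<epsilon>" by (rule future_nonneg[OF \<epsilon>])
  have dig: "0 \<le> \<epsilon> n \<and> \<epsilon> n \<le> r" and nxt: "\<epsilon> n = r \<Longrightarrow> \<epsilon> (n + 1) = 0" for n
    using \<epsilon> \<sigma> by (auto simp: symbolic_compactum_def)
  have nxt': "\<epsilon> (int n) = r \<Longrightarrow> \<epsilon> (int (Suc n)) = 0" for n
    using nxt[of "int n"] by (simp add: add.commute)
  have prv: "\<epsilon> (-1 - int (Suc n)) = r \<Longrightarrow> \<epsilon> (-1 - int n) = 0" for n
    using nxt[of "-1 - int (Suc n)"] by (simp add: algebra_simps)
  note F = future_bounds_minus[OF \<sigma>, of "\<lambda>n. \<epsilon> (int n)", OF dig nxt']
  note P = past_bounds_minus[OF \<sigma>, of "\<lambda>n. \<epsilon> (-1 - int n)", OF dig prv]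
  show "future \<epsilon> \<le> \<beta>" unfolding future_def
    by (rule suminf_le_const[OF summable_future[OF \<epsilon>]]) (use F in auto)
  define G where "G = (\<Sum>k. real_of_int (\<epsilon> (-1 - int k)) * \<mu>^k)"
  have lim: "(\<lambda>N. \<Sum>k<N. real_of_int (\<epsilon> (-1 - int k)) * \<mu>^k) \<longlonglongrightarrow> G"
    unfolding G_def by (rule summable_LIMSEQ[OF past_eq(1)[OF \<epsilon>]])
  have G: "-1 \<le> G" "G \<le> \<beta>" "\<epsilon> (-1) \<noteq> r \<Longrightarrow> G \<le> \<beta> - 1"
    using LIMSEQ_le_const[OF lim, of "-1"] LIMSEQ_le_const2[OF lim] P by auto
  have mu: "past \<epsilon> = - (G / \<beta>)"
    using past_eq(2)[OF \<epsilon>] mu_eq \<sigma> by (simp add: G_def)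
  have "G / \<beta> \<le> 1" "- (1 / \<beta>) \<le> G / \<beta>"
    using G(2) beta_gt_1 divide_right_mono[OF G(1), of \<beta>] by auto
  thus "-1 \<le> past \<epsilon>" "past \<epsilon> \<le> 1/\<beta>" unfolding mu by linarith+
  show "past \<epsilon> \<ge> -1 + 1/\<beta> \<or> future \<epsilon> \<le> 1"
  proof (cases "\<epsilon> (-1) = r")
    case True
    hence "\<epsilon> 0 = 0" using nxt[of "-1"] by simp
    have "future \<epsilon> \<le> 1" unfolding future_def
      by (rule suminf_le_const[OF summable_future[OF \<epsilon>]]) (use F \<open>\<epsilon> 0 = 0\<close> in auto)
    thus ?thesis ..
  next
    case False
    have "G / \<beta> \<le> 1 - 1 / \<beta>"
      using divide_right_mono[OF G(3)[OF False], of \<beta>] beta_gt_1 by (simp add: diff_divide_distrib)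
    thus ?thesis unfolding mu by linarith
  qed
qed

lemma tile_plus:
  assumes \<sigma>: "\<sigma> = 1" and \<epsilon>: "\<epsilon> \<in> X"
  shows "0 \<le> future \<epsilon>" "future \<epsilon> \<le> \<beta>" "0 \<le> past \<epsilon>" "past \<epsilon> \<le> 1"
    "past \<epsilon> \<le> 1 - 1/\<beta> \<or> future \<epsilon> \<le> \<beta> - 1"
proof -
  show "0 \<le> future \<epsilon>" by (rule future_nonneg[OF \<epsilon>])
  have dig: "0 \<le> \<epsilon> n \<and> \<epsilon> n \<le> r - 1" for n
    using \<epsilon> \<sigma> by (auto simp: symbolic_compactum_def)
  have block: False if "\<epsilon> n = r - 1" "\<forall>i\<in>{1..int j}. \<epsilon> (n + i) = r - 2" "\<epsilon> (n + int j + 1) = r - 1" for n j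
    using \<epsilon> \<sigma> that unfolding symbolic_compactum_def by (simp split: if_splits) blast
  have fut: "\<not> leads_high (\<lambda>i. \<epsilon> (int (Suc (n + i))))" if "\<epsilon> (int n) = r - 1" for n
  proof
    assume "leads_high (\<lambda>i. \<epsilon> (int (Suc (n + i))))"
    then obtain j where j: "\<And>i. i < j \<Longrightarrow> \<epsilon> (int (Suc (n + i))) = r - 2" "\<epsilon> (int (Suc (n + j))) = r - 1"
      by (auto simp: leads_high_def)
    show False
    proof (rule block[OF that, of j], safe)
      fix i assume "i \<in> {1..int j}"
      thus "\<epsilon> (int n + i) = r - 2" using j(1)[of "nat (i - 1)"] by (auto simp: algebra_simps)
    qed (use j(2) in \<open>simp add: algebra_simps\<close>)
  qed
  \<comment> \<open>Read backwards, the block starts at the far end of the high word and ends at the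
    digit \<open>-1 - n\<close>.\<close>
  have pst: "\<not> leads_high (\<lambda>i. \<epsilon> (-1 - int (Suc (n + i))))" if "\<epsilon> (-1 - int n) = r - 1" for n
  proof
    assume "leads_high (\<lambda>i. \<epsilon> (-1 - int (Suc (n + i))))"
    then obtain j where j: "\<And>i. i < j \<Longrightarrow> \<epsilon> (-1 - int (Suc (n + i))) = r - 2"
        "\<epsilon> (-1 - int (Suc (n + j))) = r - 1"
      by (auto simp: leads_high_def)
    show False
    proof (rule block[OF j(2), of j], safe)
      fix i assume "i \<in> {1..int j}"
      hence "nat (int j - i) < j" "-1 - int (Suc (n + nat (int j - i))) = -1 - int (Suc (n + j)) + i"
        by auto
      thus "\<epsilon> (-1 - int (Suc (n + j)) + i) = r - 2"
        using j(1) by metis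
    qed (use that in \<open>simp add: algebra_simps\<close>)
  qed
  \<comment> \<open>A high past and a high future join across the origin to a forbidden block with
    \<open>k + j\<close> middle digits.\<close>
  have both: False if high: "leads_high (\<lambda>n. \<epsilon> (int n))" "leads_high (\<lambda>n. \<epsilon> (-1 - int n))"
  proof -
    obtain j where j: "\<And>i. i < j \<Longrightarrow> \<epsilon> (int i) = r - 2" "\<epsilon> (int j) = r - 1"
      using high(1) by (auto simp: leads_high_def)
    obtain k where k: "\<And>i. i < k \<Longrightarrow> \<epsilon> (-1 - int i) = r - 2" "\<epsilon> (-1 - int k) = r - 1"
      using high(2) by (auto simp: leads_high_def)
    show False
    proof (rule block[OF k(2), of "k + j"], safe)
      fix i assume i: "i \<in> {1..int (k + j)}"
      show "\<epsilon> (-1 - int k + i) = r - 2"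
      proof (cases "i \<le> int k")
        case True
        have "nat (int k - i) < k" "-1 - int (nat (int k - i)) = -1 - int k + i" using True i by auto
        thus ?thesis using k(1) by metis
      next
        case False
        have "nat (-1 - int k + i) < j" "int (nat (-1 - int k + i)) = -1 - int k + i" using False i by auto
        thus ?thesis using j(1) by metis
      qed
    qed (use j(2) in \<open>simp add: algebra_simps\<close>)
  qed
  note F = bounds_plus[OF \<sigma>, of "\<lambda>n. \<epsilon> (int n)", OF dig fut]
  note P = bounds_plus[OF \<sigma>, of "\<lambda>n. \<epsilon> (-1 - int n)", OF dig pst]
  have mu: "\<mu> = 1 / \<beta>" using mu_eq \<sigma> by simp
  show "future \<epsilon> \<le> \<beta>" unfolding future_def
    by (rule suminf_le_const[OF summable_future[OF \<epsilon>]]) (use F in auto)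
  define G where "G = (\<Sum>k. real_of_int (\<epsilon> (-1 - int k)) * \<mu>^k)"
  have G: "0 \<le> G" "G \<le> \<beta>" "\<not> leads_high (\<lambda>n. \<epsilon> (-1 - int n)) \<Longrightarrow> G \<le> \<beta> - 1"
  proof -
    have P': "(\<Sum>k<N. real_of_int (\<epsilon> (-1 - int k)) * \<mu>^k) \<le> \<beta>"
      "\<not> leads_high (\<lambda>n. \<epsilon> (-1 - int n)) \<Longrightarrow> (\<Sum>k<N. real_of_int (\<epsilon> (-1 - int k)) * \<mu>^k) \<le> \<beta> - 1" for N
      using P unfolding mu by blast+
    show "0 \<le> G"
      unfolding G_def using dig beta_gt_1 by (intro suminf_nonneg past_eq(1)[OF \<epsilon>]) (simp add: mu)
    show "G \<le> \<beta>" unfolding G_def by (rule suminf_le_const[OF past_eq(1)[OF \<epsilon>] P'(1)])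
    show "\<not> leads_high (\<lambda>n. \<epsilon> (-1 - int n)) \<Longrightarrow> G \<le> \<beta> - 1"
      unfolding G_def by (rule suminf_le_const[OF past_eq(1)[OF \<epsilon>] P'(2)])
  qed
  have past: "past \<epsilon> = G / \<beta>"
    using past_eq(2)[OF \<epsilon>] mu by (simp add: G_def)
  show "0 \<le> past \<epsilon>" "past \<epsilon> \<le> 1" unfolding past using G beta_gt_1 by auto
  show "past \<epsilon> \<le> 1 - 1/\<beta> \<or> future \<epsilon> \<le> \<beta> - 1"
  proof (cases "leads_high (\<lambda>n. \<epsilon> (-1 - int n))")
    case True
    have "future \<epsilon> \<le> \<beta> - 1" unfolding future_def
      by (rule suminf_le_const[OF summable_future[OF \<epsilon>]]) (use F both True in auto)
    thus ?thesis ..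
  next
    case False
    show ?thesis
      using divide_right_mono[OF G(3)[OF False], of \<beta>] beta_gt_1
      unfolding past by (simp add: diff_divide_distrib)
  qed
qed

subsection \<open>The ring generated by the unit\<close>

text \<open>This is \<int>[\<beta>], which contains \<mu> as well. It contains the coordinates of
  all edges of the two rectangles, is stable under the shift and is countable, so points with a
  coordinate in it can serve as the exceptional set.\<close>

definition ring :: "real set" where
  "ring = {real_of_int i + real_of_int j * \<beta> | i j. True}"

lemma ringI: "x = real_of_int i + real_of_int j * \<beta> \<Longrightarrow> x \<in> ring"
  by (auto simp: ring_def)

lemma ring_of_int: "real_of_int k \<in> ring"
  by (rule ringI[of _ k 0]) simp

lemma ring_beta: "\<beta> \<in> ring"
  by (rule ringI[of _ 0 1]) simp

lemma ring_add: "x \<in> ring \<Longrightarrow> y \<in> ring \<Longrightarrow> x + y \<in> ring"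
  unfolding ring_def mem_Collect_eq
proof (elim exE conjE, hypsubst)
  fix i j i' j' :: int
  show "\<exists>k l. real_of_int i + real_of_int j * \<beta> + (real_of_int i' + real_of_int j' * \<beta>) = real_of_int k + real_of_int l * \<beta> \<and> True"
    by (intro exI[of _ "i + i'"] exI[of _ "j + j'"]) (simp add: algebra_simps)
qed

lemma ring_int_mult: "x \<in> ring \<Longrightarrow> real_of_int k * x \<in> ring"
  unfolding ring_def mem_Collect_eq
proof (elim exE conjE, hypsubst)
  fix i j :: int
  show "\<exists>i' j'. real_of_int k * (real_of_int i + real_of_int j * \<beta>) = real_of_int i' + real_of_int j' * \<beta> \<and> True"
    by (intro exI[of _ "k * i"] exI[of _ "k * j"]) (simp add: algebra_simps)
qed

lemma ring_diff: "x \<in> ring \<Longrightarrow> y \<in> ring \<Longrightarrow> x - y \<in> ring"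
  using ring_add[of x "real_of_int (-1) * y"] ring_int_mult[of y "-1"] by simp

lemma ring_beta_mult: "x \<in> ring \<Longrightarrow> \<beta> * x \<in> ring"
  unfolding ring_def mem_Collect_eq
proof (elim exE conjE, hypsubst)
  fix i j :: int
  have "\<beta> * (real_of_int i + real_of_int j * \<beta>) = i * \<beta> + j * (\<beta> * \<beta>)"
    by (simp add: algebra_simps)
  thus "\<exists>i' j'. \<beta> * (real_of_int i + real_of_int j * \<beta>) = real_of_int i' + real_of_int j' * \<beta> \<and> True"
    by (intro exI[of _ "- j * \<sigma>"] exI[of _ "i + j * r"]) (simp add: beta_sq algebra_simps)
qed

lemma ring_beta_divide: "x \<in> ring \<Longrightarrow> x / \<beta> \<in> ring"
proof -
  assume x: "x \<in> ring"
  have "x / \<beta> = x * (1 / \<beta>)" by simp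
  also have "\<dots> = real_of_int \<sigma> * (real_of_int r * x - \<beta> * x)"
    by (subst inverse_beta) (simp add: algebra_simps)
  finally show ?thesis using x by (auto intro!: ring_int_mult ring_diff ring_beta_mult)
qed

lemma ring_mu_mult: "x \<in> ring \<Longrightarrow> \<mu> * x \<in> ring"
  using ring_int_mult[OF ring_beta_divide, of x \<sigma>] by (simp add: mu_eq)

lemma ring_mu_divide: "x \<in> ring \<Longrightarrow> x / \<mu> \<in> ring"
  using ring_int_mult[OF ring_beta_mult, of x \<sigma>] sign_cases by (auto simp: mu_eq mult_ac)

lemma ring_mu: "real_of_int i + real_of_int j * \<mu> \<in> ring"
proof -
  have "\<mu> = r - \<beta>" using beta_plus_mu by simp
  thus ?thesis by (intro ringI[of _ "i + j * r" "- j"]) (simp only: of_int_add of_int_mult of_int_minus, simp only: algebra_simps)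
qed

text \<open>The map is the action of the shift on \<open>future\<close>; with its analogue for
  \<open>past\<close> it makes avoiding \<open>ring\<close> a shift-invariant condition, in both
  time directions.\<close>

lemma ring_beta_shift: "\<beta> * (x - real_of_int k) \<in> ring \<longleftrightarrow> x \<in> ring"
proof
  assume "\<beta> * (x - real_of_int k) \<in> ring"
  from ring_add[OF ring_beta_divide[OF this] ring_of_int[of k]] show "x \<in> ring" by simp
qed (intro ring_beta_mult ring_diff ring_of_int)

lemma ring_mu_shift: "\<mu> * (x + real_of_int k) \<in> ring \<longleftrightarrow> x \<in> ring"
proof
  assume "\<mu> * (x + real_of_int k) \<in> ring"
  from ring_diff[OF ring_mu_divide[OF this] ring_of_int[of k]] show "x \<in> ring" by simp
qed (intro ring_mu_mult ring_add ring_of_int)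

subsection \<open>Shifting and injectivity\<close>

text \<open>
  \<open>codes \<epsilon> u w\<close>: the point of \<open>\<real>\<^sup>2\<close> given by \<open>\<epsilon>\<close> agrees with \<open>(u, w)\<close> modulo the lattice of the
  pairs of conjugates in \<open>\<int>[\<beta>]\<close>.
\<close>
definition codes :: "(int \<Rightarrow> int) \<Rightarrow> real \<Rightarrow> real \<Rightarrow> bool" where
  "codes \<epsilon> u w \<longleftrightarrow> (\<exists>i j. future \<epsilon> - u = real_of_int i + real_of_int j * \<beta> \<and>
                    - past \<epsilon> - w = real_of_int i + real_of_int j * \<mu>)"

lemma shift_in_X: assumes "\<epsilon> \<in> X" shows "(\<lambda>n. \<epsilon> (n + k)) \<in> X"
proof (cases "\<sigma> = -1")
  case True
  have "\<epsilon> (m + 1) = 0" if "\<epsilon> m = r" for m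
    using assms True that by (simp add: symbolic_compactum_def)
  hence "\<epsilon> (n + 1 + k) = 0" if "\<epsilon> (n + k) = r" for n
    using that by (metis add.assoc add.commute)
  thus ?thesis using assms True by (simp add: symbolic_compactum_def)
next
  case False
  have no: "\<not> (\<epsilon> m = r - 1 \<and> (\<forall>i\<in>{1..int j}. \<epsilon> (m + i) = r - 2) \<and> \<epsilon> (m + int j + 1) = r - 1)" for m j
    using assms False unfolding symbolic_compactum_def by simp
  have "\<not> (\<epsilon> (n + k) = r - 1 \<and> (\<forall>i\<in>{1..int j}. \<epsilon> (n + i + k) = r - 2) \<and> \<epsilon> (n + int j + 1 + k) = r - 1)" for n j
    using no[of "n + k" j] by (simp add: algebra_simps)
  thus ?thesis using assms False by (simp add: symbolic_compactum_def)
qed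

lemma future_shift:
  assumes "\<epsilon> \<in> X" shows "future (\<lambda>n. \<epsilon> (n + 1)) = \<beta> * (future \<epsilon> - \<epsilon> 0)"
proof -
  let ?f = "\<lambda>n. real_of_int (\<epsilon> (int n)) * (1/\<beta>)^n"
  have "future \<epsilon> - \<epsilon> 0 = (\<Sum>n. ?f (Suc n))"
    using suminf_split_head[OF summable_future[OF assms]] by (simp add: future_def)
  also have "\<beta> * \<dots> = (\<Sum>n. \<beta> * ?f (Suc n))"
    using summable_future[OF assms] by (intro suminf_mult[symmetric]) (subst summable_Suc_iff)
  also have "\<dots> = future (\<lambda>n. \<epsilon> (n + 1))"
    unfolding future_def by (intro suminf_cong) (simp add: add.commute)
  finally show ?thesis by simp
qed

lemma past_shift:
  assumes "\<epsilon> \<in> X" shows "past (\<lambda>n. \<epsilon> (n + 1)) = \<mu> * (past \<epsilon> + \<epsilon> 0)"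
proof -
  let ?g = "\<lambda>k. real_of_int (\<epsilon> (- int k)) * \<mu>^Suc k"
  have sm: "summable ?g"
    using summable_past[OF shift_in_X[OF assms, of 1]] by simp
  have "past (\<lambda>n. \<epsilon> (n + 1)) = suminf ?g" by (simp add: past_def)
  also have "\<dots> = ?g 0 + (\<Sum>k. ?g (Suc k))"
    using suminf_split_head[OF sm] by simp
  also have "(\<Sum>k. ?g (Suc k)) = (\<Sum>k. \<mu> * (real_of_int (\<epsilon> (-1 - int k)) * \<mu>^Suc k))"
    by (intro suminf_cong) (simp add: algebra_simps)
  also have "\<dots> = \<mu> * past \<epsilon>"
    unfolding past_def by (rule suminf_mult[OF summable_past[OF assms]])
  finally show ?thesis by (simp add: algebra_simps)
qed

text \<open>On the pair (future, -past) the shift subtracts the lattice vector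
  (\<open>\<epsilon> 0\<close>, \<open>\<epsilon> 0\<close>) and multiplies by (\<beta>, \<mu>).
  Multiplication by a unit maps the lattice of conjugate pairs onto itself, which gives both
  directions.\<close>

lemma codes_shift:
  assumes "\<epsilon> \<in> X"
  shows "codes (\<lambda>n. \<epsilon> (n + 1)) (\<beta> * u) (\<mu> * w) \<longleftrightarrow> codes \<epsilon> u w"
proof -
  have mu_sq: "\<mu> * \<mu> = r * \<mu> - \<sigma>"
    using beta_plus_mu beta_times_mu by (metis add_diff_cancel_left' distrib_right)
  have *: "codes (\<lambda>n. \<epsilon> (n + 1)) (\<beta> * u) (\<mu> * w) \<longleftrightarrow>
     (\<exists>i j. \<beta> * (future \<epsilon> - u - \<epsilon> 0) = real_of_int i + real_of_int j * \<beta> \<and>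
            \<mu> * (- past \<epsilon> - w - \<epsilon> 0) = real_of_int i + real_of_int j * \<mu>)"
  proof -
    have "\<beta> * (future \<epsilon> - \<epsilon> 0) - \<beta> * u = \<beta> * (future \<epsilon> - u - \<epsilon> 0)"
      "- (\<mu> * (past \<epsilon> + \<epsilon> 0)) - \<mu> * w = \<mu> * (- past \<epsilon> - w - \<epsilon> 0)"
      by (simp_all add: algebra_simps)
    thus ?thesis
      unfolding codes_def future_shift[OF assms] past_shift[OF assms] by simp
  qed
  show ?thesis
  proof
    assume "codes \<epsilon> u w"
    then obtain i j where 1: "future \<epsilon> - u = real_of_int i + real_of_int j * \<beta>"
        and 2: "- past \<epsilon> - w = real_of_int i + real_of_int j * \<mu>"
      by (auto simp: codes_def)
    have "\<beta> * (real_of_int i + j * \<beta> - \<epsilon> 0) = i * \<beta> + j * (\<beta> * \<beta>) - \<epsilon> 0 * \<beta>"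
      "\<mu> * (real_of_int i + j * \<mu> - \<epsilon> 0) = i * \<mu> + j * (\<mu> * \<mu>) - \<epsilon> 0 * \<mu>"
      by (simp_all add: algebra_simps)
    hence "\<beta> * (future \<epsilon> - u - \<epsilon> 0) = real_of_int (- j * \<sigma>) + real_of_int (i + j * r - \<epsilon> 0) * \<beta>"
      "\<mu> * (- past \<epsilon> - w - \<epsilon> 0) = real_of_int (- j * \<sigma>) + real_of_int (i + j * r - \<epsilon> 0) * \<mu>"
      unfolding 1 2 beta_sq mu_sq by (simp_all add: algebra_simps)
    thus "codes (\<lambda>n. \<epsilon> (n + 1)) (\<beta> * u) (\<mu> * w)" unfolding * by blast
  next
    assume "codes (\<lambda>n. \<epsilon> (n + 1)) (\<beta> * u) (\<mu> * w)"
    then obtain i j where 1: "\<beta> * (future \<epsilon> - u - \<epsilon> 0) = real_of_int i + real_of_int j * \<beta>"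
        and 2: "\<mu> * (- past \<epsilon> - w - \<epsilon> 0) = real_of_int i + real_of_int j * \<mu>"
      unfolding * by blast
    define k where "k = j + \<sigma> * i * r + \<epsilon> 0"
    have "future \<epsilon> - u - \<epsilon> 0 = i * (1 / \<beta>) + j" "- past \<epsilon> - w - \<epsilon> 0 = i * (1 / \<mu>) + j"
      using 1 2 by (simp_all add: field_simps)
    hence "future \<epsilon> - u = real_of_int k + real_of_int (- \<sigma> * i) * \<beta>"
      "- past \<epsilon> - w = real_of_int k + real_of_int (- \<sigma> * i) * \<mu>"
      unfolding inverse_beta inverse_mu k_def by (simp_all add: algebra_simps)
    thus "codes \<epsilon> u w" unfolding codes_def by blast
  qed
qed

text \<open>The two points differ by a lattice vector
  \<open>(i + j * \<beta>, i + j * \<mu>)\<close>. Subtracting its coordinates isolates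
  \<open>j * (\<beta> - \<mu>)\<close>, and the size of the tile leaves only j = -1, 0, 1. Avoiding
  \<open>ring\<close> makes every tile inequality strict, which rules out all but the zero
  vector.\<close>

lemma tiles_disjoint:
  assumes \<epsilon>: "\<epsilon> \<in> X" "future \<epsilon> \<notin> ring" "past \<epsilon> \<notin> ring"
    and \<epsilon>': "\<epsilon>' \<in> X" "future \<epsilon>' \<notin> ring" "past \<epsilon>' \<notin> ring"
    and codes: "codes \<epsilon> (future \<epsilon>') (- past \<epsilon>')"
  shows "future \<epsilon> = future \<epsilon>' \<and> past \<epsilon> = past \<epsilon>'"
proof -
  define a a' b b' q where "a = future \<epsilon>" "a' = future \<epsilon>'" "b = past \<epsilon>" "b' = past \<epsilon>'" "q = 1 / \<beta>"
  note defs = this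
  obtain i j :: int where ij: "a - a' = i + j * \<beta>" "b' - b = i + j * \<mu>"
    using codes by (auto simp: codes_def defs)
  have q: "0 < q" "q < 1" using beta_gt_1 by (auto simp: defs)
  have notin: "x \<notin> ring \<Longrightarrow> y \<in> ring \<Longrightarrow> x \<le> y \<Longrightarrow> x < y" "x \<notin> ring \<Longrightarrow> y \<in> ring \<Longrightarrow> y \<le> x \<Longrightarrow> y < x" for x y :: real
    by (cases "x = y"; auto)+
  have "q \<in> ring" using ring_beta_divide[OF ring_of_int[of 1]] by (simp add: defs)
  moreover have "1 \<in> ring" "-1 \<in> ring" "0 \<in> ring"
    using ring_of_int[of 1] ring_of_int[of "-1"] ring_of_int[of 0] by simp_all
  ultimately have mem: "1 \<in> ring" "-1 \<in> ring" "0 \<in> ring" "q \<in> ring" "\<beta> \<in> ring" "\<beta> - 1 \<in> ring"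
      "1 - q \<in> ring" "-1 + q \<in> ring"
    by (auto intro: ring_diff ring_add ring_beta)
  have "i = 0 \<and> j = 0"
  proof (cases "\<sigma> = -1")
    case True
    have \<mu>: "\<mu> = - q" using True mu_eq by (simp add: defs)
    have bd: "0 < a" "a < \<beta>" "-1 < b" "b < q" "b > -1 + q \<or> a < 1"
      using tile_minus[OF True \<epsilon>(1)] \<epsilon>(2,3) mem notin unfolding defs by blast+
    have bd': "0 < a'" "a' < \<beta>" "-1 < b'" "b' < q" "b' > -1 + q \<or> a' < 1"
      using tile_minus[OF True \<epsilon>'(1)] \<epsilon>'(2,3) mem notin unfolding defs by blast+
    have "j * (\<beta> + q) < 2 * (\<beta> + q)" "(-2) * (\<beta> + q) < j * (\<beta> + q)"
      using bd bd' ij beta_gt_1 q unfolding \<mu> by (simp_all add: algebra_simps)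
    moreover have "0 \<le> \<beta> + q" using beta_gt_1 q(1) by linarith
    ultimately have "real_of_int j < 2" "-2 < real_of_int j" using mult_right_less_imp_less by blast+
    hence "j = 0 \<or> j = 1 \<or> j = -1" by linarith
    thus ?thesis
    proof (elim disjE)
      assume "j = 0"
      hence "real_of_int i < 1" "real_of_int i > -1" using ij bd bd' by auto
      thus ?thesis using \<open>j = 0\<close> by simp
    next
      assume "j = 1"
      hence "real_of_int i < 0" "real_of_int i > -1" using ij bd bd' \<mu> by auto
      thus ?thesis by simp
    next
      assume "j = -1"
      hence "real_of_int i > 0" "real_of_int i < 1" using ij bd bd' \<mu> by auto
      thus ?thesis by simp
    qed
  next
    case False
    hence \<sigma>: "\<sigma> = 1" "r \<ge> 3" using sign_cases by auto
    have \<mu>: "\<mu> = q" using \<sigma> mu_eq by (simp add: defs)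
    have bd: "0 < a" "a < \<beta>" "0 < b" "b < 1" "b < 1 - q \<or> a < \<beta> - 1"
      using tile_plus[OF \<sigma>(1) \<epsilon>(1)] \<epsilon>(2,3) mem notin unfolding defs by blast+
    have bd': "0 < a'" "a' < \<beta>" "0 < b'" "b' < 1" "b' < 1 - q \<or> a' < \<beta> - 1"
      using tile_plus[OF \<sigma>(1) \<epsilon>'(1)] \<epsilon>'(2,3) mem notin unfolding defs by blast+
    have "\<beta> > 2" using beta_plus_mu \<sigma>(2) \<mu> q by linarith
    hence "2 * q < 1" by (simp add: defs field_simps)
    \<comment> \<open>The coordinates of the tile range over intervals of lengths
      \<open>\<beta>\<close> and 1, so \<open>j * (\<beta> - q)\<close> is below
      \<open>\<beta> + 1\<close> in absolute value.\<close>
    hence "\<beta> + 1 < 2 * (\<beta> - q)" using \<open>\<beta> > 2\<close> by (simp add: algebra_simps)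
    hence "j * (\<beta> - q) < 2 * (\<beta> - q)" "(-2) * (\<beta> - q) < j * (\<beta> - q)"
      using bd bd' ij unfolding \<mu> by (simp_all add: algebra_simps)
    moreover have "0 \<le> \<beta> - q" using \<open>\<beta> > 2\<close> q by linarith
    ultimately have "real_of_int j < 2" "-2 < real_of_int j" using mult_right_less_imp_less by blast+
    hence "j = 0 \<or> j = 1 \<or> j = -1" by linarith
    thus ?thesis
    proof (elim disjE)
      assume "j = 0"
      hence "real_of_int i < 1" "real_of_int i > -1" using ij bd bd' by auto
      thus ?thesis using \<open>j = 0\<close> by simp
    next
      assume "j = 1"
      hence "real_of_int i < 0" "real_of_int i > -2" using ij bd bd' \<mu> q by auto
      \<comment> \<open>Here the L-shape matters: the translation would put \<open>a\<close> above
        \<open>\<beta> - 1\<close> and \<open>b\<close> above \<open>1 - q\<close>, in the corner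
        missing from the tile. The case j = -1 is the same with the points exchanged.\<close>
      hence "i = -1" by linarith
      thus ?thesis using ij bd bd' \<mu> \<open>j = 1\<close> by auto
    next
      assume "j = -1"
      hence "real_of_int i > 0" "real_of_int i < 2" using ij bd bd' \<mu> q by auto
      hence "i = 1" by linarith
      thus ?thesis using ij bd bd' \<mu> \<open>j = -1\<close> by auto
    qed
  qed
  thus ?thesis using ij by (simp add: defs)
qed

text \<open>The relation \<open>P\<close> survives the shift and its inverse, and
  \<open>tiles_disjoint\<close> turns it into equal coordinates. Equality before and after one shift
  forces equal digits at 0, hence at every index.\<close>

lemma codes_inject:
  assumes \<epsilon>: "\<epsilon> \<in> X" "future \<epsilon> \<notin> ring" "past \<epsilon> \<notin> ring"
    and \<epsilon>': "\<epsilon>' \<in> X" "future \<epsilon>' \<notin> ring" "past \<epsilon>' \<notin> ring"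
    and codes: "codes \<epsilon> (future \<epsilon>') (- past \<epsilon>')"
  shows "\<epsilon> = \<epsilon>'"
proof -
  define P where "P = (\<lambda>\<epsilon> \<epsilon>'. \<epsilon> \<in> X \<and> future \<epsilon> \<notin> ring \<and> past \<epsilon> \<notin> ring \<and>
    \<epsilon>' \<in> X \<and> future \<epsilon>' \<notin> ring \<and> past \<epsilon>' \<notin> ring \<and> codes \<epsilon> (future \<epsilon>') (- past \<epsilon>'))"
  have eq: "future \<epsilon> = future \<epsilon>'" "past \<epsilon> = past \<epsilon>'" if "P \<epsilon> \<epsilon>'" for \<epsilon> \<epsilon>'
    using tiles_disjoint that unfolding P_def by blast+
  have same: "codes \<epsilon> (future \<epsilon>') (- past \<epsilon>')" if "future \<epsilon> = future \<epsilon>'" "past \<epsilon> = past \<epsilon>'" for \<epsilon> \<epsilon>'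
    unfolding codes_def using that by (intro exI[of _ 0]) simp
  have step: "\<epsilon> 0 = \<epsilon>' 0 \<and> P (\<lambda>n. \<epsilon> (n + 1)) (\<lambda>n. \<epsilon>' (n + 1))" if P: "P \<epsilon> \<epsilon>'" for \<epsilon> \<epsilon>'
  proof -
    have X: "\<epsilon> \<in> X" "\<epsilon>' \<in> X" using P by (auto simp: P_def)
    have c: "codes (\<lambda>n. \<epsilon> (n + 1)) (future (\<lambda>n. \<epsilon>' (n + 1))) (- past (\<lambda>n. \<epsilon>' (n + 1)))"
    proof -
      \<comment> \<open>With equal coordinates before the shift, the shifted points differ by the
        conjugate pair \<open>k * \<beta>\<close>, \<open>k * \<mu>\<close>.\<close>
      define k where "k = \<epsilon>' 0 - \<epsilon> 0"
      have "future (\<lambda>n. \<epsilon> (n + 1)) - future (\<lambda>n. \<epsilon>' (n + 1)) = real_of_int 0 + real_of_int k * \<beta>"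
        "- past (\<lambda>n. \<epsilon> (n + 1)) - - past (\<lambda>n. \<epsilon>' (n + 1)) = real_of_int 0 + real_of_int k * \<mu>"
        unfolding future_shift[OF X(1)] future_shift[OF X(2)] past_shift[OF X(1)] past_shift[OF X(2)]
          eq[OF P] k_def by (simp_all add: algebra_simps)
      thus ?thesis unfolding codes_def by blast
    qed
    have P': "P (\<lambda>n. \<epsilon> (n + 1)) (\<lambda>n. \<epsilon>' (n + 1))"
      using P c shift_in_X[of \<epsilon> 1] shift_in_X[of \<epsilon>' 1]
      by (simp add: P_def future_shift past_shift ring_beta_shift ring_mu_shift)
    have "\<beta> * (future \<epsilon> - \<epsilon> 0) = \<beta> * (future \<epsilon>' - \<epsilon>' 0)"
      using eq(1)[OF P'] X by (simp add: future_shift)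
    hence "\<epsilon> 0 = \<epsilon>' 0" using eq(1)[OF P] by simp
    thus ?thesis using P' by blast
  qed
  have unstep: "P (\<lambda>n. \<epsilon> (n - 1)) (\<lambda>n. \<epsilon>' (n - 1))" if P: "P \<epsilon> \<epsilon>'" for \<epsilon> \<epsilon>'
  proof -
    define \<delta> \<delta>' where "\<delta> = (\<lambda>n. \<epsilon> (n - 1))" "\<delta>' = (\<lambda>n. \<epsilon>' (n - 1))"
    have sh: "\<epsilon> = (\<lambda>n. \<delta> (n + 1))" "\<epsilon>' = (\<lambda>n. \<delta>' (n + 1))" by (auto simp: \<delta>_\<delta>'_def)
    have X: "\<delta> \<in> X" "\<delta>' \<in> X"
      using P shift_in_X[of \<epsilon> "-1"] shift_in_X[of \<epsilon>' "-1"] by (auto simp: P_def \<delta>_\<delta>'_def)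
    have ni: "future \<delta> \<notin> ring" "past \<delta> \<notin> ring" "future \<delta>' \<notin> ring" "past \<delta>' \<notin> ring"
      using P unfolding P_def sh future_shift[OF X(1)] future_shift[OF X(2)] past_shift[OF X(1)]
        past_shift[OF X(2)] ring_beta_shift ring_mu_shift by auto
    have eq': "\<beta> * (future \<delta> - \<delta> 0) = \<beta> * (future \<delta>' - \<delta>' 0)"
        "\<mu> * (past \<delta> + \<delta> 0) = \<mu> * (past \<delta>' + \<delta>' 0)"
      using eq[OF P] unfolding sh future_shift[OF X(1)] future_shift[OF X(2)] past_shift[OF X(1)]
        past_shift[OF X(2)] by auto
    hence "future \<delta> - future \<delta>' = real_of_int (\<delta> 0 - \<delta>' 0) + real_of_int 0 * \<beta>"
       "- past \<delta> - - past \<delta>' = real_of_int (\<delta> 0 - \<delta>' 0) + real_of_int 0 * \<mu>"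
      by simp_all
    hence "codes \<delta> (future \<delta>') (- past \<delta>')" unfolding codes_def by blast
    thus ?thesis using X ni unfolding P_def \<delta>_\<delta>'_def by blast
  qed
  have "P (\<lambda>m. \<epsilon> (m + n)) (\<lambda>m. \<epsilon>' (m + n))" for n
  proof (induction n rule: int_induct[of _ 0])
    case base
    show ?case using assms by (simp add: P_def)
  next
    case (step1 i)
    show ?case using step[OF step1.IH] by (simp add: algebra_simps)
  next
    case (step2 i)
    show ?case using unstep[OF step2.IH] by (simp add: algebra_simps)
  qed
  hence "\<epsilon> (0 + n) = \<epsilon>' (0 + n)" for n using step by blast
  thus ?thesis by auto
qed

subsection \<open>Greedy expansions and surjectivity\<close>

text \<open>The digit opening a forbidden block, \<open>r\<close> or \<open>r - 1\<close> according
  to the sign, is positive, so no such block can begin in the zero past.\<close>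

lemma zero_padded_in_X:
  fixes d :: "nat \<Rightarrow> int"
  assumes "\<And>n. 0 \<le> d n"
    and "\<sigma> = -1 \<Longrightarrow> (\<And>n. d n \<le> r \<and> (d n = r \<longrightarrow> d (Suc n) = 0))"
    and "\<sigma> = 1 \<Longrightarrow> (\<And>n. d n \<le> r - 1 \<and> (d n = r - 1 \<longrightarrow> \<not> leads_high (\<lambda>i. d (Suc (n + i)))))"
  shows "(\<lambda>n. if n < 0 then 0 else d (nat n)) \<in> X"
proof (cases "\<sigma> = -1")
  case True
  hence "r \<ge> 1" using sign_cases by auto
  have "d (nat (n + 1)) = 0" if "d (nat n) = r" "n \<ge> 0" for n
    using assms(2)[OF True, of "nat n"] that by (simp add: nat_add_distrib)
  thus ?thesis
    unfolding X_minus_iff[OF True] using assms(1) assms(2)[OF True] \<open>r \<ge> 1\<close> by simp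
next
  case False
  hence \<sigma>: "\<sigma> = 1" "r \<ge> 3" using sign_cases by auto
  let ?\<epsilon> = "\<lambda>n. if n < 0 then 0 else d (nat n)"
  have "\<not> (?\<epsilon> n = r - 1 \<and> (\<forall>i\<in>{1..int j}. ?\<epsilon> (n + i) = r - 2) \<and> ?\<epsilon> (n + int j + 1) = r - 1)" for n j
  proof (intro notI, elim conjE)
    assume *: "?\<epsilon> n = r - 1" "\<forall>i\<in>{1..int j}. ?\<epsilon> (n + i) = r - 2" "?\<epsilon> (n + int j + 1) = r - 1"
    have n: "n \<ge> 0" using *(1) \<sigma>(2) by (auto split: if_splits)
    define m where "m = nat n"
    have m: "n = int m" using n by (simp add: m_def)
    have "d (Suc (m + i)) = r - 2" if "i < j" for i
    proof -
      have "int (Suc i) \<in> {1..int j}" using that by auto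
      hence "?\<epsilon> (n + int (Suc i)) = r - 2" using *(2) by blast
      moreover have "nat (n + int (Suc i)) = Suc (m + i)" unfolding m by linarith
      ultimately show ?thesis using m by simp
    qed
    moreover have "nat (n + int j + 1) = Suc (m + j)" unfolding m by linarith
    hence "d (Suc (m + j)) = r - 1" using *(3) m by simp
    ultimately have "leads_high (\<lambda>i. d (Suc (m + i)))" unfolding leads_high_def by blast
    moreover have "d m = r - 1" using *(1) m by simp
    ultimately show False using assms(3)[OF \<sigma>(1), of m] by blast
  qed
  moreover have "0 \<le> ?\<epsilon> n \<and> ?\<epsilon> n \<le> r - 1" for n
    using \<sigma>(2) assms(1)[of "nat n"] assms(3)[OF \<sigma>(1), of "nat n"] by simp
  ultimately show ?thesis unfolding X_plus_iff[OF \<sigma>(1)] by blast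
qed

text \<open>The digits are the integer parts along the orbit of x under z \<mapsto> \<beta> frac z.
  Admissibility holds because a largest digit leaves a small fractional part, as
  \<open>1/\<beta>\<close> is \<open>\<beta> - r\<close> or \<open>r - \<beta>\<close>.\<close>

lemma greedy_expansion:
  assumes x: "0 \<le> x" "x < \<beta>"
  shows "\<exists>\<epsilon>\<in>X. future \<epsilon> = x \<and> past \<epsilon> = 0"
proof -
  define z where "z = rec_nat x (\<lambda>_ y. \<beta> * frac y)"
  have z0: "z 0 = x" and zS: "z (Suc n) = \<beta> * frac (z n)" for n
    by (simp_all add: z_def)
  define d where "d = (\<lambda>n. \<lfloor>z n\<rfloor>)"
  have z: "0 \<le> z n \<and> z n < \<beta>" for n
  proof (cases n)
    case (Suc m)
    have "frac (z m) < 1" by (rule frac_lt_1)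
    thus ?thesis using beta_gt_1 Suc by (simp add: zS)
  qed (use x in \<open>simp add: z0\<close>)
  have d0: "0 \<le> d n" for n using z[of n] by (simp add: d_def)
  have minus: "d n \<le> r \<and> (d n = r \<longrightarrow> d (Suc n) = 0)" if "\<sigma> = -1" for n
  proof -
    have inv: "1 / \<beta> = \<beta> - r" using inverse_beta that by simp
    moreover have "1 / \<beta> < 1" using beta_gt_1 by simp
    ultimately have "\<beta> < r + 1" by linarith
    hence "z n < real_of_int (r + 1)" using z[of n] by simp
    hence "d n < r + 1" unfolding d_def by (simp only: floor_less_iff)
    moreover have "d (Suc n) = 0" if "d n = r"
    proof -
      have "frac (z n) < 1 / \<beta>" using z[of n] that unfolding inv frac_def d_def by simp
      hence "z (Suc n) < 1" using beta_gt_1 by (simp add: zS field_simps)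
      thus ?thesis using z[of "Suc n"] by (simp add: d_def floor_eq_iff)
    qed
    ultimately show ?thesis by simp
  qed
  have plus: "d n \<le> r - 1 \<and> (d n = r - 1 \<longrightarrow> \<not> leads_high (\<lambda>i. d (Suc (n + i))))" if "\<sigma> = 1" for n
  proof -
    have inv: "1 / \<beta> = r - \<beta>" using inverse_beta that by simp
    moreover have "1 / \<beta> > 0" using beta_gt_1 by simp
    ultimately have \<beta>: "\<beta> < r" by linarith
    hence "z n < real_of_int r" using z[of n] by simp
    hence "d n < r" unfolding d_def by (simp only: floor_less_iff)
    have next_small: "z (Suc m) < \<beta> - 1" if "frac (z m) < 1 - 1 / \<beta>" for m
      using that beta_gt_1 by (simp add: zS field_simps)
    \<comment> \<open>A digit \<open>r - 1\<close> drives the orbit below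
      \<open>\<beta> - 1\<close>. There the digit \<open>r - 1\<close> cannot occur, and each digit
      \<open>r - 2\<close> keeps the orbit there, so the block is never completed.\<close>
    have persist: "d m \<noteq> r - 1 \<and> (d m = r - 2 \<longrightarrow> z (Suc m) < \<beta> - 1)" if "z m < \<beta> - 1" for m
    proof -
      have "z m < real_of_int (r - 1)" using that \<beta> by simp
      hence "d m < r - 1" unfolding d_def by (simp only: floor_less_iff)
      moreover have "z (Suc m) < \<beta> - 1" if "d m = r - 2"
        using \<open>z m < \<beta> - 1\<close> that by (intro next_small) (simp add: inv frac_def d_def)
      ultimately show ?thesis by simp
    qed
    have "\<not> leads_high (\<lambda>i. d (Suc (n + i)))" if "d n = r - 1"
    proof
      assume "leads_high (\<lambda>i. d (Suc (n + i)))"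
      then obtain j where j: "\<And>i. i < j \<Longrightarrow> d (Suc (n + i)) = r - 2" "d (Suc (n + j)) = r - 1"
        by (auto simp: leads_high_def)
      have "z (Suc (n + i)) < \<beta> - 1" if "i \<le> j" for i
        using that
      proof (induction i)
        case 0
        show ?case using \<open>d n = r - 1\<close> z[of n] by (simp add: next_small inv frac_def d_def)
      next
        case (Suc i)
        thus ?case using persist[of "Suc (n + i)"] j(1)[of i] by simp
      qed
      from persist[OF this[of j]] j(2) show False by simp
    qed
    thus ?thesis using \<open>d n < r\<close> by simp
  qed
  define \<epsilon> where "\<epsilon> = (\<lambda>n. if n < 0 then 0 else d (nat n))"
  have \<epsilon>: "\<epsilon> \<in> X" unfolding \<epsilon>_def by (rule zero_padded_in_X[OF d0 minus plus])
  have "past \<epsilon> = 0" by (simp add: past_def \<epsilon>_def)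
  \<comment> \<open>The sum telescopes, with a remainder that vanishes since the orbit is bounded by
    \<open>\<beta>\<close>.\<close>
  have sum: "(\<Sum>k<n. d k * (1/\<beta>)^k) = x - z n * (1/\<beta>)^n" for n
  proof (induction n)
    case (Suc n)
    have "d n = z n - z (Suc n) / \<beta>" by (simp add: zS frac_def d_def)
    hence "d n * (1/\<beta>)^n = z n * (1/\<beta>)^n - z (Suc n) * (1/\<beta>)^Suc n"
      by (simp add: left_diff_distrib)
    thus ?case using Suc by simp
  qed (simp add: z0)
  have "(\<lambda>n. z n * (1/\<beta>)^n) \<longlonglongrightarrow> 0"
  proof (rule tendsto_sandwich[of "\<lambda>_. 0" _ _ "\<lambda>n. \<beta> * (1/\<beta>)^n"])
    show "(\<lambda>n. \<beta> * (1/\<beta>)^n) \<longlonglongrightarrow> 0"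
      using beta_gt_1 by (intro tendsto_mult_right_zero LIMSEQ_realpow_zero) auto
  qed (use z beta_gt_1 in \<open>auto intro!: always_eventually mult_right_mono divide_right_mono less_imp_le\<close>)
  hence "(\<lambda>n. \<Sum>k<n. d k * (1/\<beta>)^k) \<longlonglongrightarrow> x - 0"
    unfolding sum by (intro tendsto_diff tendsto_const)
  hence "(\<lambda>k. d k * (1/\<beta>)^k) sums x" by (simp add: sums_def)
  hence "future \<epsilon> = x" by (simp add: future_def \<epsilon>_def sums_iff)
  thus ?thesis using \<epsilon> \<open>past \<epsilon> = 0\<close> by blast
qed

text \<open>
  Pull \<open>(u, w)\<close> back \<open>N\<close> steps, translate it into a strip \<open>[0, 1) \<times> [0, C]\<close>, expand the first
  coordinate greedily, and shift forward again: the error in the second coordinate contracts.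
\<close>
lemma codes_approx:
  "\<exists>\<epsilon>\<in>X. \<exists>v. 0 \<le> v \<and> v \<le> 1 + (\<beta> - \<mu>) \<and> codes \<epsilon> u (w - \<mu>^N * v)"
proof -
  define u0 w0 where "u0 = u / \<beta>^N" "w0 = w / \<mu>^N"
  note u0w0 = this
  have pos: "\<beta> - \<mu> > 0" using mu_less_beta by simp
  \<comment> \<open>Adding the integer \<open>i\<close> does not change \<open>v - x\<close>, so
    \<open>j\<close> is used first to bring this difference into a period of length
    \<open>\<beta> - \<mu>\<close>, and \<open>i\<close> then moves \<open>x\<close> into [0,
    1).\<close>
  define j where "j = \<lfloor>(w0 - u0) / (\<beta> - \<mu>)\<rfloor>"
  define i where "i = - \<lfloor>u0 + j * \<beta>\<rfloor>"
  define x v where "x = u0 + i + j * \<beta>" "v = w0 + i + j * \<mu>"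
  note xv = this
  have x: "0 \<le> x" "x < 1" unfolding xv i_def by linarith+
  have "j * (\<beta> - \<mu>) \<le> w0 - u0"
    using of_int_floor_le[of "(w0 - u0) / (\<beta> - \<mu>)"] unfolding j_def pos_le_divide_eq[OF pos] .
  moreover have "(w0 - u0) / (\<beta> - \<mu>) < real_of_int j + 1"
    unfolding j_def by linarith
  hence "w0 - u0 < (real_of_int j + 1) * (\<beta> - \<mu>)" using pos by (simp add: pos_divide_less_eq)
  moreover have "v - x = (w0 - u0) - j * (\<beta> - \<mu>)" unfolding xv by (simp add: algebra_simps)
  ultimately have v: "0 \<le> v - x" "v - x \<le> \<beta> - \<mu>" by (simp_all add: algebra_simps)
  obtain \<epsilon> where \<epsilon>: "\<epsilon> \<in> X" "future \<epsilon> = x" "past \<epsilon> = 0"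
    using greedy_expansion[of x] x beta_gt_1 by auto
  have "codes \<epsilon> u0 (w0 - v)"
    unfolding codes_def \<epsilon>(2,3) by (intro exI[of _ i] exI[of _ j]) (simp add: xv)
  have shifted: "(\<lambda>m. \<epsilon> (m + int n)) \<in> X \<and> codes (\<lambda>m. \<epsilon> (m + int n)) (\<beta>^n * u0) (\<mu>^n * (w0 - v))" for n
  proof (induction n)
    case (Suc n)
    from Suc shift_in_X[OF conjunct1[OF Suc], of 1] codes_shift[of "\<lambda>m. \<epsilon> (m + int n)" "\<beta>^n * u0" "\<mu>^n * (w0 - v)"]
    show ?case by (simp add: algebra_simps)
  qed (use \<epsilon> \<open>codes \<epsilon> u0 (w0 - v)\<close> in simp)
  have "\<beta>^N * u0 = u" "\<mu>^N * (w0 - v) = w - \<mu>^N * v"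
    by (simp_all add: u0w0 algebra_simps)
  thus ?thesis using shifted[of N] v x by (intro bexI[of _ "\<lambda>m. \<epsilon> (m + int N)"] exI[of _ v]) auto
qed

section \<open>Compactness of the symbolic space\<close>

lemma X_closed:
  assumes "\<And>N. x N \<in> X" "\<And>n. \<forall>\<^sub>F N in sequentially. x N n = \<epsilon> n"
  shows "\<epsilon> \<in> X"
proof -
  \<comment> \<open>Every defining condition involves a finite window of digits, and on such a
    window the limit coincides with some member of the sequence.\<close>
  have agree: "\<exists>N. \<forall>n\<in>S. x N n = \<epsilon> n" if "finite S" for S
    using eventually_ball_finite[OF that, of "\<lambda>N n. x N n = \<epsilon> n" sequentially] assms(2)
    by (metis (mono_tags, lifting) eventually_happens' sequentially_bot)
  show ?thesis
  proof (cases "\<sigma> = -1")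
    case True
    have "(0 \<le> \<epsilon> n \<and> \<epsilon> n \<le> r) \<and> (\<epsilon> n = r \<longrightarrow> \<epsilon> (n + 1) = 0)" for n
    proof -
      obtain N where "x N n = \<epsilon> n" "x N (n + 1) = \<epsilon> (n + 1)"
        using agree[of "{n, n + 1}"] by auto
      moreover have "(0 \<le> x N n \<and> x N n \<le> r) \<and> (x N n = r \<longrightarrow> x N (n + 1) = 0)"
        using assms(1)[of N] unfolding X_minus_iff[OF True] by blast
      ultimately show ?thesis by simp
    qed
    thus ?thesis unfolding X_minus_iff[OF True] by blast
  next
    case False
    hence \<sigma>: "\<sigma> = 1" using sign_cases by auto
    have "0 \<le> \<epsilon> n \<and> \<epsilon> n \<le> r - 1" for n
    proof -
      obtain N where "x N n = \<epsilon> n" using agree[of "{n}"] by auto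
      moreover have "0 \<le> x N n \<and> x N n \<le> r - 1"
        using assms(1)[of N] unfolding X_plus_iff[OF \<sigma>] by blast
      ultimately show ?thesis by simp
    qed
    moreover have False if *: "\<epsilon> n = r - 1" "\<forall>i\<in>{1..int j}. \<epsilon> (n + i) = r - 2" "\<epsilon> (n + int j + 1) = r - 1" for n j
    proof -
      obtain N where N: "\<forall>m\<in>{n..n + int j + 1}. x N m = \<epsilon> m"
        using agree[of "{n..n + int j + 1}"] by auto
      hence "x N n = r - 1 \<and> (\<forall>i\<in>{1..int j}. x N (n + i) = r - 2) \<and> x N (n + int j + 1) = r - 1"
        using * by auto
      moreover have "\<not> (x N n = r - 1 \<and> (\<forall>i\<in>{1..int j}. x N (n + i) = r - 2) \<and> x N (n + int j + 1) = r - 1)"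
        using assms(1)[of N] unfolding X_plus_iff[OF \<sigma>] by blast
      ultimately show False by blast
    qed
    ultimately show ?thesis
      unfolding X_plus_iff[OF \<sigma>] by blast
  qed
qed

text \<open>Tychonoff's theorem for a countable product of finite digit sets; convergence of a
  discrete coordinate means that it is eventually constant.\<close>

lemma X_subsequence:
  fixes x :: "nat \<Rightarrow> int \<Rightarrow> int"
  assumes "\<And>N. x N \<in> X"
  shows "\<exists>f \<epsilon>. strict_mono f \<and> \<epsilon> \<in> X \<and> (\<forall>n. \<forall>\<^sub>F N in sequentially. x (f N) n = \<epsilon> n)"
proof -
  define y where "y = (\<lambda>N n. nat (x N n))"
  have xy: "x N n = int (y N n)" for N n
    using digit_bounds[OF assms, of N n] by (simp add: y_def)
  have "compact (PiE UNIV (\<lambda>_::int. {0..nat r}))"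
    using compactin_PiE[of "\<lambda>_::int. euclidean" UNIV "\<lambda>_. {0..nat r}"]
    by (simp add: euclidean_product_topology finite_imp_compact)
  hence "seq_compact (PiE UNIV (\<lambda>_::int. {0..nat r}))"
    by (rule compact_imp_seq_compact)
  moreover have "\<forall>N. y N \<in> PiE UNIV (\<lambda>_::int. {0..nat r})"
    using digit_bounds[OF assms] by (auto simp: y_def intro!: nat_mono)
  ultimately obtain e f where f: "strict_mono f" and lim: "(y \<circ> f) \<longlonglongrightarrow> e"
    by (rule seq_compactE)
  have ev: "\<forall>\<^sub>F N in sequentially. x (f N) n = int (e n)" for n
  proof -
    have "continuous_on UNIV (\<lambda>y::int \<Rightarrow> nat. y n)" by (rule continuous_on_product_coordinates)
    hence "((\<lambda>N. (y \<circ> f) N n) \<longlongrightarrow> e n) sequentially"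
      using lim by (rule continuous_on_tendsto_compose) auto
    thus ?thesis by (simp add: tendsto_discrete xy)
  qed
  have "(\<lambda>n. int (e n)) \<in> X" by (rule X_closed[of "\<lambda>N. x (f N)"]) (use assms ev in auto)
  with f ev show ?thesis by (intro exI[of _ f] exI[of _ "\<lambda>n. int (e n)"]) simp
qed

lemma future_past_tendsto:
  assumes X: "\<And>N. x N \<in> X" and ev: "\<And>n. \<forall>\<^sub>F N in sequentially. x N n = \<epsilon> n"
  shows "(\<lambda>N. future (x N)) \<longlonglongrightarrow> future \<epsilon>" "(\<lambda>N. past (x N)) \<longlonglongrightarrow> past \<epsilon>"
proof -
  have "(\<lambda>N. real_of_int (x N m) * c) \<longlonglongrightarrow> real_of_int (\<epsilon> m) * c" for m c
    by (rule tendsto_eventually) (use ev[of m] in \<open>auto elim: eventually_mono\<close>)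
  note lim = this
  show "(\<lambda>N. future (x N)) \<longlonglongrightarrow> future \<epsilon>"
    unfolding future_def
    by (rule tannerys_theorem[where M = "\<lambda>n. r * (1/\<beta>)^n", THEN conjunct2, THEN conjunct2])
      (use lim future_term_bound[OF X] summable_geometric_beta in \<open>auto intro!: always_eventually\<close>)
  show "(\<lambda>N. past (x N)) \<longlonglongrightarrow> past \<epsilon>"
    unfolding past_def
    by (rule tannerys_theorem[where M = "\<lambda>n. r * (1/\<beta>)^n", THEN conjunct2, THEN conjunct2])
      (use lim past_term_bound[OF X] summable_geometric_beta in \<open>auto intro!: always_eventually simp del: power_Suc\<close>)
qed

text \<open>A limit of the approximate codes is an exact code: \<open>future\<close> and
  \<open>past\<close> are continuous on \<open>X\<close>, the error tends to 0, and the lattice of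
  conjugate pairs is closed.\<close>

lemma codes_surj: "\<exists>\<epsilon>\<in>X. codes \<epsilon> u w"
proof -
  obtain x v where xv: "\<And>N. x N \<in> X" "\<And>N. 0 \<le> v N \<and> v N \<le> 1 + (\<beta> - \<mu>)"
      "\<And>N. codes (x N) u (w - \<mu>^N * v N)"
    using codes_approx by metis
  obtain f \<epsilon> where f: "strict_mono f" and \<epsilon>: "\<epsilon> \<in> X"
      and ev: "\<And>n. \<forall>\<^sub>F N in sequentially. x (f N) n = \<epsilon> n"
    using X_subsequence[of x, OF xv(1)] by blast
  have lim: "(\<lambda>N. future (x (f N))) \<longlonglongrightarrow> future \<epsilon>" "(\<lambda>N. past (x (f N))) \<longlonglongrightarrow> past \<epsilon>"
    using future_past_tendsto[of "\<lambda>N. x (f N)", OF xv(1) ev] by auto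
  have "(\<lambda>N. \<mu>^N * v N) \<longlonglongrightarrow> 0"
  proof (rule Lim_null_comparison[of _ "\<lambda>N. (1/\<beta>)^N * (1 + (\<beta> - \<mu>))"])
    show "\<forall>\<^sub>F N in sequentially. norm (\<mu>^N * v N) \<le> (1/\<beta>)^N * (1 + (\<beta> - \<mu>))"
      using xv(2) by (intro always_eventually) (auto simp: abs_mult power_abs abs_mu[symmetric] intro!: mult_left_mono)
    show "(\<lambda>N. (1/\<beta>)^N * (1 + (\<beta> - \<mu>))) \<longlonglongrightarrow> 0"
      using beta_gt_1 by (intro tendsto_mult_left_zero LIMSEQ_realpow_zero) auto
  qed
  hence lim0: "(\<lambda>N. \<mu>^f N * v (f N)) \<longlonglongrightarrow> 0"
    using LIMSEQ_subseq_LIMSEQ[OF _ f] by (fastforce simp: o_def)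
  define P Q where "P = (\<lambda>N. future (x (f N)) - u)" "Q = (\<lambda>N. - past (x (f N)) - (w - \<mu>^f N * v (f N)))"
  note PQ = this
  have P: "P \<longlonglongrightarrow> future \<epsilon> - u" and Q: "Q \<longlonglongrightarrow> - past \<epsilon> - (w - 0)"
    unfolding PQ by (intro tendsto_diff tendsto_minus lim lim0 tendsto_const)+
  have nz: "\<beta> - \<mu> \<noteq> 0" using mu_less_beta by simp
  \<comment> \<open>Cramer's rule recovers j and i from a conjugate pair, so that lattice membership
    becomes integrality of two continuous expressions.\<close>
  have int: "(P N - Q N) / (\<beta> - \<mu>) \<in> \<int> \<and> (\<beta> * Q N - \<mu> * P N) / (\<beta> - \<mu>) \<in> \<int>" for N
  proof -
    obtain i j where "P N = real_of_int i + real_of_int j * \<beta>" "Q N = real_of_int i + real_of_int j * \<mu>"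
      using xv(3)[of "f N"] unfolding codes_def PQ by blast
    hence "(P N - Q N) = real_of_int j * (\<beta> - \<mu>)" "\<beta> * Q N - \<mu> * P N = real_of_int i * (\<beta> - \<mu>)"
      by (simp_all add: algebra_simps)
    thus ?thesis using nz by simp
  qed
  have "(\<lambda>N. (P N - Q N) / (\<beta> - \<mu>)) \<longlonglongrightarrow> (future \<epsilon> - u - (- past \<epsilon> - w)) / (\<beta> - \<mu>)"
    "(\<lambda>N. (\<beta> * Q N - \<mu> * P N) / (\<beta> - \<mu>)) \<longlonglongrightarrow> (\<beta> * (- past \<epsilon> - w) - \<mu> * (future \<epsilon> - u)) / (\<beta> - \<mu>)"
    using P Q nz by (auto intro!: tendsto_intros)
  hence "(future \<epsilon> - u - (- past \<epsilon> - w)) / (\<beta> - \<mu>) \<in> \<int>"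
    "(\<beta> * (- past \<epsilon> - w) - \<mu> * (future \<epsilon> - u)) / (\<beta> - \<mu>) \<in> \<int>"
    using int by (metis (no_types, lifting) closed_Ints closed_sequentially)+
  then obtain i j where "(future \<epsilon> - u - (- past \<epsilon> - w)) / (\<beta> - \<mu>) = real_of_int j"
    "(\<beta> * (- past \<epsilon> - w) - \<mu> * (future \<epsilon> - u)) / (\<beta> - \<mu>) = real_of_int i"
    by (auto elim!: Ints_cases)
  hence j: "future \<epsilon> - u - (- past \<epsilon> - w) = j * (\<beta> - \<mu>)"
    and i: "\<beta> * (- past \<epsilon> - w) - \<mu> * (future \<epsilon> - u) = i * (\<beta> - \<mu>)"
    using nz by (simp_all add: divide_eq_eq)
  have "(\<beta> - \<mu>) * (future \<epsilon> - u) = (\<beta> - \<mu>) * (real_of_int i + real_of_int j * \<beta>)"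
  proof -
    have "(\<beta> - \<mu>) * (future \<epsilon> - u) = \<beta> * (future \<epsilon> - u - (- past \<epsilon> - w)) + (\<beta> * (- past \<epsilon> - w) - \<mu> * (future \<epsilon> - u))"
      by (simp add: algebra_simps)
    thus ?thesis unfolding i j by (simp add: algebra_simps)
  qed
  hence "future \<epsilon> - u = real_of_int i + real_of_int j * \<beta>" using nz by simp
  moreover from this j have "- past \<epsilon> - w = real_of_int i + real_of_int j * \<mu>"
    by (simp add: algebra_simps)
  ultimately show ?thesis using \<epsilon> unfolding codes_def by blast
qed

end

subsection \<open>Integer vectors and the torus\<close>

definition intvec :: "real^2 \<Rightarrow> bool" where
  "intvec x \<longleftrightarrow> (\<forall>i. x $ i \<in> \<int>)"

lemma torus_proj_eq_iff: "torus_proj x = torus_proj y \<longleftrightarrow> intvec (x - y)"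
  by (simp add: torus.abs_eq_iff lattice_equiv_def intvec_def)

lemma intvec_add: "intvec x \<Longrightarrow> intvec y \<Longrightarrow> intvec (x + y)"
  and intvec_diff: "intvec x \<Longrightarrow> intvec y \<Longrightarrow> intvec (x - y)"
  and intvec_scale: "intvec x \<Longrightarrow> intvec (real_of_int k *\<^sub>R x)"
  and intvec_0 [simp]: "intvec 0"
  by (auto simp: intvec_def)

lemma intvec_sum: "(\<And>i. i \<in> A \<Longrightarrow> intvec (f i)) \<Longrightarrow> intvec (sum f A)"
  by (simp add: intvec_def Ints_sum)

lemma intvec_matrix: "intvec x \<Longrightarrow> intvec (real_matrix M *v x)"
  using lattice_equiv_real_matrix[of x 0 M] by (simp add: lattice_equiv_def intvec_def)

lemma intvec_small:
  assumes "intvec x" "norm x < 1" shows "x = 0"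
proof -
  have "x $ i = 0" for i
  proof -
    obtain k where k: "x $ i = real_of_int k" using assms(1) by (auto simp: intvec_def elim: Ints_cases)
    have "\<bar>x $ i\<bar> < 1" using component_le_norm_cart[of x i] assms(2) by linarith
    thus ?thesis using k by simp
  qed
  thus ?thesis by (simp add: vec_eq_iff)
qed

lemma tendsto_torus_proj: "(f \<longlongrightarrow> l) F \<Longrightarrow> ((\<lambda>x. torus_proj (f x)) \<longlongrightarrow> torus_proj l) F"
  using continuous_torus_proj by (rule continuous_on_tendsto_compose) auto

text \<open>The preimage of the projected ball is the union of its integer translates, so the
  projected ball is an open neighbourhood of the origin.\<close>

lemma tendsto_torus_projD:
  fixes x :: "nat \<Rightarrow> real^2"
  assumes "(\<lambda>n. torus_proj (x n)) \<longlonglongrightarrow> torus_proj 0" "e > 0"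
  shows "\<forall>\<^sub>F n in sequentially. \<exists>z. intvec z \<and> norm (x n - z) < e"
proof -
  have "torus_proj -` (torus_proj ` ball 0 e) = (\<Union>z\<in>Collect intvec. ball z e)"
  proof (intro set_eqI iffI)
    fix y assume "y \<in> torus_proj -` (torus_proj ` ball 0 e)"
    then obtain z where "torus_proj y = torus_proj z" "z \<in> ball 0 e" by blast
    thus "y \<in> (\<Union>z\<in>Collect intvec. ball z e)"
      by (intro UN_I[of "y - z"]) (auto simp: torus_proj_eq_iff dist_norm)
  next
    fix y assume "y \<in> (\<Union>z\<in>Collect intvec. ball z e)"
    then obtain z where "intvec z" "y \<in> ball z e" by blast
    hence "torus_proj y = torus_proj (y - z)" "y - z \<in> ball 0 e"
      by (auto simp: torus_proj_eq_iff dist_norm norm_minus_commute)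
    thus "y \<in> torus_proj -` (torus_proj ` ball 0 e)" by blast
  qed
  moreover have "open (\<Union>z\<in>Collect intvec. ball z e)" by blast
  ultimately have "open (torus_proj ` ball 0 e)" by (simp only: open_torus_def)
  moreover have "torus_proj 0 \<in> torus_proj ` ball 0 e" using assms(2) by simp
  ultimately have "\<forall>\<^sub>F n in sequentially. torus_proj (x n) \<in> torus_proj ` ball 0 e"
    using assms(1) by (rule topological_tendstoD[rotated 1])
  thus ?thesis
  proof eventually_elim
    case (elim n)
    then obtain y where "norm y < e" "torus_proj (x n) = torus_proj y" by auto
    thus ?case by (intro exI[of _ "x n - y"]) (auto simp: torus_proj_eq_iff)
  qed
qed

section \<open>Plane determinants\<close>

definition cross :: "real^2 \<Rightarrow> real^2 \<Rightarrow> real" where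
  "cross x y = x $ 1 * y $ 2 - x $ 2 * y $ 1"

lemma cross_simps [simp]:
  "cross (x + y) z = cross x z + cross y z" "cross x (y + z) = cross x y + cross x z"
  "cross (x - y) z = cross x z - cross y z" "cross x (y - z) = cross x y - cross x z"
  "cross (c *\<^sub>R x) z = c * cross x z" "cross x (c *\<^sub>R z) = c * cross x z" "cross x x = 0"
  by (simp_all add: cross_def algebra_simps)

lemma cross_antisym: "cross y x = - cross x y"
  by (simp add: cross_def)

text \<open>Cramer's rule in a form free of division.\<close>

lemma cross_decompose:
  "cross t s *\<^sub>R x = cross x s *\<^sub>R t + cross t x *\<^sub>R s"
  by (simp add: vec_eq_iff forall_2 cross_def algebra_simps)

section \<open>The eigenline splitting of integer vectors\<close>

locale torus_automorphism =
  quadratic_unit "trace M" "det M" "dominant_eigenvalue M" \<mu> for M :: "int^2^2" and \<mu>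
begin

abbreviation "\<beta> \<equiv> dominant_eigenvalue M"

abbreviation L :: "real^2 \<Rightarrow> real^2" where "L x \<equiv> real_matrix M *v x"

lemmas L_linear = matrix_vector_right_distrib matrix_vector_mult_diff_distrib
  matrix_vector_mult_scaleR

lemma cayley_hamilton: "L (L x) = real_of_int (trace M) *\<^sub>R L x - real_of_int (det M) *\<^sub>R x"
  by (simp add: vec_eq_iff forall_2 matrix_vector_mult_def real_matrix_def trace_def det_2 sum_2 algebra_simps)

text \<open>The inverse as given by Cayley-Hamilton; with a unit determinant it visibly preserves
  integer vectors.\<close>

definition L_inv :: "real^2 \<Rightarrow> real^2" where
  "L_inv x = real_of_int (det M) *\<^sub>R (real_of_int (trace M) *\<^sub>R x - L x)"

lemma L_inv_L: "L_inv (L x) = x"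
proof -
  have "real_of_int (det M) * det M = 1"
    using sigma_sq by (metis of_int_1 of_int_mult)
  thus ?thesis by (simp add: L_inv_def cayley_hamilton)
qed

lemma intvec_L_inv: "intvec x \<Longrightarrow> intvec (L_inv x)"
  unfolding L_inv_def by (intro intvec_scale intvec_diff intvec_matrix)

text \<open>This and \<open>contracting\<close> are the spectral projections onto the \<beta>- and
  \<mu>-eigenlines.\<close>

definition expanding :: "real^2 \<Rightarrow> real^2" where
  "expanding m = (1 / (\<beta> - \<mu>)) *\<^sub>R (L m - \<mu> *\<^sub>R m)"

definition contracting :: "real^2 \<Rightarrow> real^2" where
  "contracting m = (1 / (\<beta> - \<mu>)) *\<^sub>R (\<beta> *\<^sub>R m - L m)"

lemma L_eigen:
  "L (L x - \<mu> *\<^sub>R x) = \<beta> *\<^sub>R (L x - \<mu> *\<^sub>R x)"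
  "L (\<beta> *\<^sub>R x - L x) = \<mu> *\<^sub>R (\<beta> *\<^sub>R x - L x)"
  unfolding L_linear cayley_hamilton beta_plus_mu[symmetric] beta_times_mu[symmetric]
  by (simp_all add: algebra_simps)

lemma L_expanding: "L (expanding m) = \<beta> *\<^sub>R expanding m"
  and L_contracting: "L (contracting m) = \<mu> *\<^sub>R contracting m"
  unfolding expanding_def contracting_def matrix_vector_mult_scaleR L_eigen
  by (simp_all add: mult.commute)

lemma expanding_linear:
  "expanding (x - y) = expanding x - expanding y" "expanding (c *\<^sub>R x) = c *\<^sub>R expanding x"
  unfolding expanding_def L_linear scaleR_diff_right[symmetric] by (simp_all add: algebra_simps)

lemma expanding_L: "expanding (L m) = \<beta> *\<^sub>R expanding m"
proof -
  have "L (L m) - \<mu> *\<^sub>R L m = \<beta> *\<^sub>R (L m - \<mu> *\<^sub>R m)"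
    using L_eigen(1)[of m] by (simp add: L_linear)
  thus ?thesis by (simp add: expanding_def mult.commute)
qed

lemma expanding_plus_contracting: "expanding m + contracting m = m"
proof -
  have "expanding m + contracting m = (1 / (\<beta> - \<mu>)) *\<^sub>R ((\<beta> - \<mu>) *\<^sub>R m)"
    unfolding expanding_def contracting_def scaleR_add_right[symmetric] by (simp add: algebra_simps)
  thus ?thesis using mu_less_beta by simp
qed

lemma L_decomp: "L m = \<beta> *\<^sub>R expanding m + \<mu> *\<^sub>R contracting m"
  using expanding_plus_contracting[of m] L_expanding L_contracting
  by (metis matrix_vector_right_distrib)

lemma intvec_power: "intvec m \<Longrightarrow> intvec (\<beta>^n *\<^sub>R expanding m + \<mu>^n *\<^sub>R contracting m)"
proof (induction n)
  case (Suc n)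
  have "L (\<beta>^n *\<^sub>R expanding m + \<mu>^n *\<^sub>R contracting m) = \<beta>^Suc n *\<^sub>R expanding m + \<mu>^Suc n *\<^sub>R contracting m"
    by (simp add: L_linear L_expanding L_contracting mult.commute)
  thus ?case using intvec_matrix[OF Suc.IH[OF Suc.prems], of M] by simp
qed (simp add: expanding_plus_contracting)

subsection \<open>The coding map\<close>

definition coded_point :: "real^2 \<Rightarrow> (int \<Rightarrow> int) \<Rightarrow> real^2" where
  "coded_point m \<epsilon> = future \<epsilon> *\<^sub>R expanding m - past \<epsilon> *\<^sub>R contracting m"

lemma symmetric_sum:
  "(\<Sum>n=-int N..int N. real_of_int (\<epsilon> n) * \<beta> powi (-n)) =
   (\<Sum>k<Suc N. \<epsilon> (int k) * (1/\<beta>)^k) + (\<Sum>k<N. \<epsilon> (-1 - int k) * \<beta>^Suc k)"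
proof (induction N)
  case (Suc N)
  have "{-int (Suc N)..int (Suc N)} = insert (int (Suc N)) (insert (-1 - int N) {-int N..int N})"
    by auto
  hence "(\<Sum>n=-int (Suc N)..int (Suc N). real_of_int (\<epsilon> n) * \<beta> powi (-n)) =
     \<epsilon> (int (Suc N)) * \<beta> powi (- int (Suc N)) + (\<epsilon> (-1 - int N) * \<beta> powi (int (Suc N)) +
     (\<Sum>n=-int N..int N. real_of_int (\<epsilon> n) * \<beta> powi (-n)))"
    by (simp add: add.commute)
  also have "\<beta> powi (- int (Suc N)) = (1/\<beta>)^Suc N"
    by (simp only: power_int_minus power_int_of_nat) (simp add: field_simps)
  also have "\<beta> powi (int (Suc N)) = \<beta>^Suc N"
    by (simp only: power_int_of_nat)
  finally show ?case unfolding Suc by simp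
qed simp

lemma coding_limit:
  assumes "\<epsilon> \<in> X" and m: "intvec m"
  shows "(\<lambda>N. torus_proj ((\<Sum>n=-int N..int N. real_of_int (\<epsilon> n) * \<beta> powi (-n)) *\<^sub>R expanding m))
          \<longlonglongrightarrow> torus_proj (coded_point m \<epsilon>)"
proof -
  define F P where "F = (\<lambda>N. \<Sum>k<Suc N. \<epsilon> (int k) * (1/\<beta>)^k)" "P = (\<lambda>N. \<Sum>k<N. \<epsilon> (-1 - int k) * \<mu>^Suc k)"
  note FP = this
  have "F \<longlonglongrightarrow> future \<epsilon>"
    unfolding FP future_def using LIMSEQ_Suc[OF summable_LIMSEQ[OF summable_future[OF assms(1)]]] .
  moreover have "P \<longlonglongrightarrow> past \<epsilon>"
    unfolding FP past_def using summable_LIMSEQ[OF summable_past[OF assms(1)]] .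
  ultimately have "(\<lambda>N. torus_proj (F N *\<^sub>R expanding m - P N *\<^sub>R contracting m)) \<longlonglongrightarrow> torus_proj (coded_point m \<epsilon>)"
    unfolding coded_point_def by (intro tendsto_torus_proj tendsto_intros)
  moreover have "torus_proj ((\<Sum>n=-int N..int N. real_of_int (\<epsilon> n) * \<beta> powi (-n)) *\<^sub>R expanding m)
     = torus_proj (F N *\<^sub>R expanding m - P N *\<^sub>R contracting m)" for N
  proof -
    have "(\<Sum>n=-int N..int N. real_of_int (\<epsilon> n) * \<beta> powi (-n)) *\<^sub>R expanding m -
        (F N *\<^sub>R expanding m - P N *\<^sub>R contracting m)
      = (\<Sum>k<N. \<epsilon> (-1 - int k) * \<beta>^Suc k) *\<^sub>R expanding m + P N *\<^sub>R contracting m"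
      unfolding symmetric_sum FP by (simp add: algebra_simps)
    \<comment> \<open>Each bracket is the integer vector M^(k+1) m, so modulo integers the diverging
      half of the sum along the expanding line is replaced by a converging one along the contracting
      line.\<close>
    also have "\<dots> = (\<Sum>k<N. real_of_int (\<epsilon> (-1 - int k)) *\<^sub>R (\<beta>^Suc k *\<^sub>R expanding m + \<mu>^Suc k *\<^sub>R contracting m))"
      unfolding FP scaleR_sum_left by (simp add: sum.distrib scaleR_add_right del: power_Suc)
    finally show ?thesis
      unfolding torus_proj_eq_iff using m by (simp only:) (intro intvec_sum intvec_scale intvec_power)
  qed
  ultimately show ?thesis by simp
qed

subsection \<open>Homoclinic points\<close>

lemma torus_map_proj: "torus_map M (torus_proj x) = torus_proj (L x)"
  by (rule torus_map.abs_eq)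

lemma torus_map_funpow:
  assumes "L t = c *\<^sub>R t" shows "(torus_map M ^^ n) (torus_proj t) = torus_proj (c^n *\<^sub>R t)"
  by (induction n) (simp_all add: torus_map_proj assms L_linear mult.commute)

lemma inj_torus_map: "inj (torus_map M)"
proof (rule injI)
  fix p q assume "torus_map M p = torus_map M q"
  moreover obtain x y where xy: "p = torus_proj x" "q = torus_proj y"
    by (metis Quotient_abs_rep Quotient_torus)
  ultimately have "intvec (L (x - y))"
    by (simp add: torus_map_proj torus_proj_eq_iff L_linear)
  from intvec_L_inv[OF this] show "p = q" by (simp add: xy L_inv_L torus_proj_eq_iff)
qed

text \<open>Forward in time, \<beta>^n t is congruent to -\<mu>^n s modulo integers, and this tends
  to 0; backward in time the lift itself contracts to 0.\<close>

lemma homoclinic_expanding: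
  assumes "intvec m" shows "homoclinic_coords M (expanding m)"
proof -
  let ?t = "expanding m" and ?s = "contracting m"
  have "torus_proj (\<beta>^n *\<^sub>R ?t) = torus_proj (- (\<mu>^n *\<^sub>R ?s))" for n
    using intvec_power[OF assms, of n] by (simp add: torus_proj_eq_iff)
  moreover have "norm \<mu> < 1"
    unfolding real_norm_def abs_mu using beta_gt_1 by simp
  hence "(\<lambda>n. torus_proj (- (\<mu>^n *\<^sub>R ?s))) \<longlonglongrightarrow> torus_proj (- (0 *\<^sub>R ?s))"
    by (intro tendsto_torus_proj tendsto_intros)
  ultimately have fwd: "(\<lambda>n. (torus_map M ^^ n) (torus_proj ?t)) \<longlonglongrightarrow> torus_proj 0"
    by (simp add: torus_map_funpow[OF L_expanding])
  have "(inv (torus_map M) ^^ n) (torus_proj ?t) = torus_proj ((1/\<beta>)^n *\<^sub>R ?t)" for n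
  proof (induction n)
    case (Suc n)
    have "torus_proj ((1/\<beta>)^n *\<^sub>R ?t) = torus_map M (torus_proj ((1/\<beta>)^Suc n *\<^sub>R ?t))"
      by (simp add: torus_map_proj L_linear L_expanding)
    thus ?case using Suc inj_torus_map by simp
  qed simp
  moreover have "(\<lambda>n. torus_proj ((1/\<beta>)^n *\<^sub>R ?t)) \<longlonglongrightarrow> torus_proj (0 *\<^sub>R ?t)"
    using beta_gt_1 by (intro tendsto_torus_proj tendsto_intros LIMSEQ_realpow_zero) auto
  ultimately have "(\<lambda>n. (inv (torus_map M) ^^ n) (torus_proj ?t)) \<longlonglongrightarrow> torus_proj 0" by simp
  with fwd show ?thesis by (simp add: homoclinic_coords_def homoclinic_def L_expanding)
qed

text \<open>
  Close to \<open>\<beta>\<^sup>n t\<close> there is an integer vector \<open>z\<^sub>n\<close> with \<open>z\<^sub>n\<^sub>+\<^sub>1 = M z\<^sub>n\<close> for large \<open>n\<close>; the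
  difference \<open>\<beta>\<^sup>n t - z\<^sub>n\<close> is then an orbit that stays bounded, so it lies on the contracting line.
\<close>
lemma homoclinic_is_expanding:
  assumes "homoclinic_coords M t" shows "\<exists>m. intvec m \<and> t = expanding m"
proof -
  have Lt: "L t = \<beta> *\<^sub>R t" using assms by (simp add: homoclinic_coords_def)
  have lim: "(\<lambda>n. torus_proj (\<beta>^n *\<^sub>R t)) \<longlonglongrightarrow> torus_proj 0"
    using assms by (simp add: homoclinic_coords_def homoclinic_def torus_map_funpow[OF Lt])
  obtain K where K: "K > 0" "\<And>x. norm (L x) \<le> K * norm x"
    using linear_bounded_pos[OF matrix_vector_mul_linear[of "real_matrix M"]] by blast
  \<comment> \<open>Chosen so that \<open>e + K * e = 1\<close>: the integer vector
    \<open>L (z n) - z (Suc n)\<close> then has norm below 1 and must vanish.\<close>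
  define e where "e = 1 / (K + 1)"
  have "e > 0" using K by (simp add: e_def)
  from tendsto_torus_projD[OF lim this] obtain N z where
    z: "\<And>n. n \<ge> N \<Longrightarrow> intvec (z n) \<and> norm (\<beta>^n *\<^sub>R t - z n) < e"
    unfolding eventually_sequentially by metis
  define \<delta> where "\<delta> = (\<lambda>n. \<beta>^n *\<^sub>R t - z n)"
  have \<delta>: "norm (\<delta> n) < e" if "n \<ge> N" for n using z[OF that] by (simp add: \<delta>_def)
  have step: "\<delta> (Suc n) = L (\<delta> n)" if "n \<ge> N" for n
  proof -
    have eq: "L (z n) - z (Suc n) = \<delta> (Suc n) - L (\<delta> n)"
      by (simp add: \<delta>_def L_linear Lt mult.commute)
    have "norm (\<delta> (Suc n) - L (\<delta> n)) \<le> norm (\<delta> (Suc n)) + norm (L (\<delta> n))"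
      by (rule norm_triangle_ineq4)
    also have "\<dots> < e + K * e"
      using \<delta>[of "Suc n"] \<delta>[OF that] K(2)[of "\<delta> n"] K(1) that
      by (intro add_less_le_mono) (auto intro: order.trans[OF _ mult_left_mono])
    also have "\<dots> = 1" using K(1) by (simp add: e_def field_simps)
    finally have "norm (L (z n) - z (Suc n)) < 1" by (simp add: eq)
    moreover have "intvec (L (z n) - z (Suc n))"
      using z[OF that] z[of "Suc n"] that by (auto intro!: intvec_diff intvec_matrix)
    ultimately have "L (z n) - z (Suc n) = 0" by (rule intvec_small[rotated])
    thus ?thesis using eq by simp
  qed
  \<comment> \<open>Up to the factor \<open>\<beta> - \<mu>\<close> this is the expanding part of
    the error. It is multiplied by \<open>\<beta>\<close> at each step and yet stays bounded, so it
    is zero.\<close>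
  define v where "v = (\<lambda>n. L (\<delta> n) - \<mu> *\<^sub>R \<delta> n)"
  have v: "v (N + k) = \<beta>^k *\<^sub>R v N" for k
  proof (induction k)
    case (Suc k)
    have "v (N + Suc k) = \<beta> *\<^sub>R v (N + k)"
      unfolding v_def using step[of "N + k"] L_eigen(1)[of "\<delta> (N + k)"] by (simp add: L_linear)
    thus ?case using Suc by simp
  qed simp
  have "norm (v N) \<le> (1/\<beta>)^k * ((K + 1) * e)" for k
  proof -
    have "norm (v (N + k)) \<le> norm (L (\<delta> (N + k))) + norm (\<mu> *\<^sub>R \<delta> (N + k))"
      unfolding v_def by (rule norm_triangle_ineq4)
    also have "norm (L (\<delta> (N + k))) \<le> K * e"
      using K(2)[of "\<delta> (N + k)"] mult_left_mono[OF less_imp_le[OF \<delta>[of "N + k"]], of K] K(1) by linarith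
    also have "norm (\<mu> *\<^sub>R \<delta> (N + k)) \<le> 1 * e"
      unfolding norm_scaleR using \<delta>[of "N + k"] abs_mu beta_gt_1 by (intro mult_mono) auto
    finally have "\<beta>^k * norm (v N) \<le> (K + 1) * e"
      using beta_gt_1 by (simp add: v algebra_simps)
    thus ?thesis using beta_gt_1 by (simp add: power_one_over field_simps)
  qed
  moreover have "(\<lambda>k. (1/\<beta>)^k * ((K + 1) * e)) \<longlonglongrightarrow> 0"
    using beta_gt_1 by (intro tendsto_mult_left_zero LIMSEQ_realpow_zero) auto
  ultimately have "norm (v N) \<le> 0" by (intro LIMSEQ_le_const[of _ _ "norm (v N)"]) auto
  hence "L (\<delta> N) - \<mu> *\<^sub>R \<delta> N = 0" by (simp add: v_def)
  hence "L (z N) - \<mu> *\<^sub>R z N = (\<beta> - \<mu>) *\<^sub>R (\<beta>^N *\<^sub>R t)"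
    by (simp add: \<delta>_def L_linear Lt algebra_simps)
  hence "expanding (z N) = \<beta>^N *\<^sub>R t" using mu_less_beta by (simp add: expanding_def)
  \<comment> \<open>The N forward steps are undone: \<open>L_inv\<close> keeps vectors integral and
    divides the expanding part by \<open>\<beta>\<close>.\<close>
  moreover have "\<exists>m. intvec m \<and> expanding m = t" if "intvec z" "expanding z = \<beta>^N *\<^sub>R t" for z N
    using that
  proof (induction N arbitrary: z)
    case (Suc N)
    have "expanding (L_inv z) = (real_of_int (det M) * (real_of_int (trace M) - \<beta>)) *\<^sub>R expanding z"
      by (simp add: L_inv_def expanding_linear expanding_L algebra_simps)
    also have "\<dots> = (1/\<beta>) *\<^sub>R expanding z" by (simp only: inverse_beta)
    finally have "expanding (L_inv z) = \<beta>^N *\<^sub>R t" using Suc.prems by simp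
    thus ?case using Suc.IH intvec_L_inv[OF Suc.prems(1)] by blast
  qed auto
  ultimately show ?thesis using z[of N] by blast
qed

text \<open>
  Otherwise \<open>m\<close> would be an eigenvector, and the integer vectors \<open>M\<^sup>-\<^sup>n m = \<beta>\<^sup>-\<^sup>n m\<close> would tend to \<open>0\<close>.
\<close>
lemma cross_expanding_contracting:
  assumes "intvec m" "expanding m \<noteq> 0"
  shows "cross (expanding m) (contracting m) \<noteq> 0"
proof
  let ?t = "expanding m" and ?s = "contracting m"
  assume 0: "cross ?t ?s = 0"
  \<comment> \<open>A vanishing determinant makes the two parts parallel; applying \<open>L\<close>
    then multiplies the same vector by two different eigenvalues, which forces the contracting part
    to be 0.\<close>
  have "(?t \<bullet> ?t) *\<^sub>R ?s = (?t \<bullet> ?s) *\<^sub>R ?t"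
    using 0 by (simp add: vec_eq_iff forall_2 inner_vec_def sum_2 cross_def algebra_simps)
  hence "L ((?t \<bullet> ?t) *\<^sub>R ?s) = L ((?t \<bullet> ?s) *\<^sub>R ?t)" by simp
  hence "\<mu> *\<^sub>R ((?t \<bullet> ?t) *\<^sub>R ?s) = \<beta> *\<^sub>R ((?t \<bullet> ?s) *\<^sub>R ?t)"
    by (simp add: L_linear L_expanding L_contracting mult.commute)
  hence "(\<mu> - \<beta>) *\<^sub>R ((?t \<bullet> ?t) *\<^sub>R ?s) = 0"
    unfolding \<open>(?t \<bullet> ?t) *\<^sub>R ?s = (?t \<bullet> ?s) *\<^sub>R ?t\<close> by (simp only: scaleR_diff_left) simp
  hence "?s = 0" using mu_less_beta assms(2) by simp
  hence t: "m = ?t" using expanding_plus_contracting[of m] by simp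
  have Lm: "L m = \<beta> *\<^sub>R m" using t L_expanding by metis
  have "intvec ((1/\<beta>)^n *\<^sub>R m)" for n
  proof (induction n)
    case (Suc n)
    have "L_inv ((1/\<beta>)^n *\<^sub>R m) = (real_of_int (det M) * (real_of_int (trace M) - \<beta>)) *\<^sub>R ((1/\<beta>)^n *\<^sub>R m)"
      by (simp add: L_inv_def L_linear Lm algebra_simps)
    also have "\<dots> = (1/\<beta>) *\<^sub>R ((1/\<beta>)^n *\<^sub>R m)" by (simp only: inverse_beta)
    finally show ?case using intvec_L_inv[OF Suc] by simp
  qed (simp add: assms)
  moreover have "(\<lambda>n. norm ((1/\<beta>)^n *\<^sub>R m)) \<longlonglongrightarrow> norm (0 *\<^sub>R m)"
    using beta_gt_1 by (intro tendsto_intros LIMSEQ_realpow_zero) auto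
  hence "\<forall>\<^sub>F n in sequentially. norm ((1/\<beta>)^n *\<^sub>R m) < 1"
    by (rule order_tendstoD) simp
  then obtain n where "norm ((1/\<beta>)^n *\<^sub>R m) < 1" using eventually_happens' sequentially_bot by blast
  ultimately have "(1/\<beta>)^n *\<^sub>R m = 0" using intvec_small by blast
  thus False using t assms(2) by simp
qed

end

context torus_automorphism
begin

subsection \<open>Preimages under the coding map\<close>

definition coordU :: "real^2 \<Rightarrow> real^2 \<Rightarrow> real" where
  "coordU m x = cross x (contracting m) / cross (expanding m) (contracting m)"

definition coordW :: "real^2 \<Rightarrow> real^2 \<Rightarrow> real" where
  "coordW m x = cross (expanding m) x / cross (expanding m) (contracting m)"

lemma coord_linear:
  "coordU m (x + y) = coordU m x + coordU m y" "coordW m (x + y) = coordW m x + coordW m y"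
  "coordU m (x - y) = coordU m x - coordU m y" "coordW m (x - y) = coordW m x - coordW m y"
  "coordU m (c *\<^sub>R x) = c * coordU m x" "coordW m (c *\<^sub>R x) = c * coordW m x"
  by (simp_all add: coordU_def coordW_def add_divide_distrib diff_divide_distrib)

lemma coord_decompose:
  assumes "cross (expanding m) (contracting m) \<noteq> 0"
  shows "x = coordU m x *\<^sub>R expanding m + coordW m x *\<^sub>R contracting m" (is "x = ?y")
proof -
  have "cross (expanding m) (contracting m) *\<^sub>R x = cross (expanding m) (contracting m) *\<^sub>R ?y"
    using cross_decompose[of "expanding m" "contracting m" x] assms
    by (simp add: coordU_def coordW_def scaleR_add_right)
  thus ?thesis using assms by simp
qed

text \<open>Along the eigenlines \<open>i m + j L m\<close> has coordinates
  \<open>i + j * \<beta>\<close> and \<open>i + j * \<mu>\<close>, so \<open>codes_surj\<close>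
  carries over with this lattice in the role of the conjugate pairs.\<close>

lemma coding_onto:
  assumes "intvec m" "expanding m \<noteq> 0"
  shows "\<exists>\<epsilon>\<in>X. \<exists>i j. coded_point m \<epsilon> - x = real_of_int i *\<^sub>R m + real_of_int j *\<^sub>R L m"
proof -
  let ?t = "expanding m" and ?s = "contracting m"
  have k: "cross ?t ?s \<noteq> 0" using cross_expanding_contracting assms by blast
  define u w where "u = coordU m x" "w = coordW m x"
  have x: "x = u *\<^sub>R ?t + w *\<^sub>R ?s" unfolding u_w_def by (rule coord_decompose[OF k])
  obtain \<epsilon> i j where \<epsilon>: "\<epsilon> \<in> X" and ij: "future \<epsilon> - u = real_of_int i + real_of_int j * \<beta>"
      "- past \<epsilon> - w = real_of_int i + real_of_int j * \<mu>"
    using codes_surj[of u w] unfolding codes_def by blast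
  have "coded_point m \<epsilon> - x = (future \<epsilon> - u) *\<^sub>R ?t + (- past \<epsilon> - w) *\<^sub>R ?s"
    unfolding coded_point_def by (subst x) (simp add: algebra_simps)
  also have "\<dots> = real_of_int i *\<^sub>R (?t + ?s) + real_of_int j *\<^sub>R (\<beta> *\<^sub>R ?t + \<mu> *\<^sub>R ?s)"
    unfolding ij by (simp add: algebra_simps)
  also have "\<dots> = real_of_int i *\<^sub>R m + real_of_int j *\<^sub>R L m"
    unfolding expanding_plus_contracting L_decomp[symmetric] ..
  finally show ?thesis using \<epsilon> by blast
qed

lemma coord_expanding_contracting:
  assumes "cross (expanding m) (contracting m) \<noteq> 0"
  shows "coordU m (expanding m) = 1" "coordU m (contracting m) = 0"
    "coordW m (expanding m) = 0" "coordW m (contracting m) = 1"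
  using assms by (simp_all add: coordU_def coordW_def)

lemma coord_lattice:
  assumes "cross (expanding m) (contracting m) \<noteq> 0"
  shows "coordU m (real_of_int i *\<^sub>R m + real_of_int j *\<^sub>R L m) = i + j * \<beta>"
    "coordW m (real_of_int i *\<^sub>R m + real_of_int j *\<^sub>R L m) = i + j * \<mu>"
proof -
  have m: "coordU m m = 1" "coordW m m = 1"
    using coord_expanding_contracting[OF assms] coord_linear(1,2)[of m "expanding m" "contracting m"]
    by (simp_all add: expanding_plus_contracting)
  have "coordU m (L m) = \<beta>" "coordW m (L m) = \<mu>"
    by (simp_all add: L_decomp coord_linear coord_expanding_contracting[OF assms])
  thus "coordU m (real_of_int i *\<^sub>R m + real_of_int j *\<^sub>R L m) = i + j * \<beta>"
    "coordW m (real_of_int i *\<^sub>R m + real_of_int j *\<^sub>R L m) = i + j * \<mu>"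
    using m by (simp_all add: coord_linear)
qed

text \<open>By \<open>gen\<close> the integer vectors are exactly the conjugate pairs in eigenline
  coordinates. Hence both codes avoid \<open>ring\<close> because \<open>x\<close> does, and
  \<open>codes_inject\<close> applies.\<close>

lemma coding_inject:
  assumes m: "intvec m" "expanding m \<noteq> 0"
    and gen: "\<And>z. intvec z \<Longrightarrow> \<exists>i j. z = real_of_int i *\<^sub>R m + real_of_int j *\<^sub>R L m"
    and x: "coordU m x \<notin> ring" "coordW m x \<notin> ring"
    and \<epsilon>: "\<epsilon> \<in> X" "torus_proj (coded_point m \<epsilon>) = torus_proj x"
    and \<epsilon>': "\<epsilon>' \<in> X" "torus_proj (coded_point m \<epsilon>') = torus_proj x"
  shows "\<epsilon> = \<epsilon>'"
proof -
  have k: "cross (expanding m) (contracting m) \<noteq> 0" using cross_expanding_contracting m by blast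
  have coords: "coordU m (coded_point m \<delta>) = future \<delta>" "coordW m (coded_point m \<delta>) = - past \<delta>" for \<delta>
    by (simp_all add: coded_point_def coord_linear coord_expanding_contracting[OF k])
  have diff: "\<exists>i j. coordU m y - coordU m z = real_of_int i + real_of_int j * \<beta> \<and>
      coordW m y - coordW m z = real_of_int i + real_of_int j * \<mu>"
    if "torus_proj y = torus_proj z" for y z
  proof -
    have "intvec (y - z)" using that by (simp add: torus_proj_eq_iff)
    then obtain i j where "y - z = real_of_int i *\<^sub>R m + real_of_int j *\<^sub>R L m" using gen by blast
    thus ?thesis using coord_lattice[OF k] by (metis coord_linear(3,4))
  qed
  have notin: "future \<delta> \<notin> ring \<and> past \<delta> \<notin> ring" if eq: "torus_proj (coded_point m \<delta>) = torus_proj x" for \<delta>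
  proof -
    obtain i j where ij: "future \<delta> - coordU m x = real_of_int i + real_of_int j * \<beta>"
      "- past \<delta> - coordW m x = real_of_int i + real_of_int j * \<mu>"
      using diff[OF eq] unfolding coords by blast
    have "coordU m x = future \<delta> - (real_of_int i + real_of_int j * \<beta>)"
      "coordW m x = real_of_int (-1) * past \<delta> - (real_of_int i + real_of_int j * \<mu>)"
      using ij by simp_all
    thus ?thesis using x ring_diff[OF _ ringI[OF refl]] ring_diff[OF ring_int_mult ring_mu] by metis
  qed
  show ?thesis
  proof (rule codes_inject)
    show "codes \<epsilon> (future \<epsilon>') (- past \<epsilon>')"
      using diff[of "coded_point m \<epsilon>" "coded_point m \<epsilon>'"] \<epsilon>(2) \<epsilon>'(2)
      unfolding coords codes_def by simp
  qed (use \<epsilon> \<epsilon>' notin in blast)+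
qed

subsection \<open>Exceptional points have measure zero\<close>

lemma countable_ring: "countable ring"
proof -
  have "ring = range (\<lambda>(i, j). real_of_int i + real_of_int j * \<beta>)"
    by (auto simp: ring_def)
  thus ?thesis by simp
qed

end

section \<open>Lebesgue measure on the torus\<close>

definition fundamental_domain :: "(real^2) set" where
  "fundamental_domain = {x. \<forall>i. 0 \<le> x $ i \<and> x $ i < 1}"

lemma torus_lebesgue_eq: "torus_lebesgue = distr (restrict_space lborel fundamental_domain) borel torus_proj"
  by (simp add: torus_lebesgue_def fundamental_domain_def)

lemma fundamental_domain_sets: "fundamental_domain \<in> sets lborel"
proof -
  have "closed {x::real^2. 0 \<le> x $ i}" "open {x::real^2. x $ i < 1}" for i
    by (auto intro!: closed_Collect_le open_Collect_less continuous_intros)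
  hence "(\<Inter>i\<in>UNIV. {x::real^2. 0 \<le> x $ i} \<inter> {x. x $ i < 1}) \<in> sets borel"
    by (intro sets.countable_INT'' sets.Int borel_open borel_closed) auto
  also have "(\<Inter>i\<in>UNIV. {x::real^2. 0 \<le> x $ i} \<inter> {x. x $ i < 1}) = fundamental_domain"
    by (auto simp: fundamental_domain_def)
  finally show ?thesis by simp
qed

lemma measurable_torus_proj: "torus_proj \<in> measurable (restrict_space lborel fundamental_domain) borel"
  by (intro measurable_restrict_space1)
    (use borel_measurable_continuous_onI[OF continuous_torus_proj] in simp)

lemma null_lborel_iff:
  fixes S :: "(real^2) set"
  assumes "S \<in> sets borel" shows "S \<in> null_sets lborel \<longleftrightarrow> negligible S"
  using assms by (simp add: negligible_iff_null_sets null_sets_completion_iff)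

lemma null_torus_iff:
  assumes "S \<in> sets borel"
  shows "S \<in> null_sets torus_lebesgue \<longleftrightarrow> negligible (torus_proj -` S \<inter> fundamental_domain)"
proof -
  have "torus_proj -` S \<in> sets borel"
    using borel_measurable_continuous_onI[OF continuous_torus_proj] assms
    by (metis measurable_sets_borel)
  hence "torus_proj -` S \<inter> fundamental_domain \<in> sets borel"
    using fundamental_domain_sets by simp
  moreover have "space (restrict_space lborel fundamental_domain) = fundamental_domain"
    by (simp add: space_restrict_space)
  ultimately show ?thesis
    unfolding torus_lebesgue_eq null_sets_distr_iff[OF measurable_torus_proj]
    using assms fundamental_domain_sets by (simp add: null_sets_restrict_space null_lborel_iff)
qed

lemma open_torus_not_null:
  assumes "open S" "S \<noteq> {}" shows "S \<notin> null_sets torus_lebesgue"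
proof
  assume "S \<in> null_sets torus_lebesgue"
  hence neg: "negligible (torus_proj -` S \<inter> fundamental_domain)"
    using null_torus_iff[of S] assms(1) by auto
  have op: "open (torus_proj -` S)" using assms(1) by (simp add: open_torus_def)
  obtain y where y: "torus_proj y \<in> S"
    using assms(2) by (metis Quotient_abs_rep Quotient_torus ex_in_conv)
  define x where "x = (\<chi> i. frac (y $ i))"
  have "torus_proj x = torus_proj y"
    by (simp add: torus_proj_eq_iff intvec_def x_def frac_def)
  hence "x \<in> torus_proj -` S" using y by simp
  \<comment> \<open>The representative may lie on the edge of the square; openness of the preimage
    then provides points in the interior.\<close>
  moreover have "x \<in> closure (box 0 1)"
  proof -
    have "(\<chi> i. 1/2) \<in> box 0 (1::real^2)" by (simp add: mem_box_cart)
    hence "closure (box 0 (1::real^2)) = cbox 0 1" by (intro closure_box) blast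
    thus ?thesis by (simp add: x_def mem_box_cart less_imp_le frac_lt_1)
  qed
  ultimately have "torus_proj -` S \<inter> box 0 1 \<noteq> {}"
    using open_Int_closure_eq_empty[OF op] by blast
  moreover have "torus_proj -` S \<inter> box 0 1 \<subseteq> torus_proj -` S \<inter> fundamental_domain"
    by (auto simp: fundamental_domain_def mem_box_cart less_imp_le)
  moreover have "open (torus_proj -` S \<inter> box 0 1)" using op by blast
  ultimately show False using neg negligible_subset open_not_negligible by blast
qed

lemma AE_torus_ex:
  assumes "AE p in torus_lebesgue. P p" shows "\<exists>p. P p"
proof (rule ccontr)
  assume "\<nexists>p. P p"
  obtain N where "{p \<in> space torus_lebesgue. \<not> P p} \<subseteq> N" "N \<in> null_sets torus_lebesgue"
    using assms by (auto simp: eventually_ae_filter)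
  moreover have "space torus_lebesgue = UNIV" by (simp add: torus_lebesgue_def)
  ultimately have "N = UNIV" using \<open>\<nexists>p. P p\<close> by auto
  hence "UNIV \<in> null_sets torus_lebesgue" using \<open>N \<in> null_sets torus_lebesgue\<close> by simp
  thus False using open_torus_not_null[of UNIV] by simp
qed

context torus_automorphism
begin

text \<open>The exceptional points lie on countably many lines parallel to the eigenlines, and each
  line is negligible.\<close>

lemma AE_generic:
  assumes m: "intvec m" "expanding m \<noteq> 0"
    and gen: "\<And>z. intvec z \<Longrightarrow> \<exists>i j. z = real_of_int i *\<^sub>R m + real_of_int j *\<^sub>R L m"
  shows "AE p in torus_lebesgue. \<forall>x. torus_proj x = p \<longrightarrow> coordU m x \<notin> ring \<and> coordW m x \<notin> ring"
proof -
  let ?t = "expanding m" and ?s = "contracting m"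
  have k: "cross ?t ?s \<noteq> 0" using cross_expanding_contracting m by blast
  define E where "E = {x. coordU m x \<in> ring \<or> coordW m x \<in> ring}"
  note decomp = coord_decompose[OF k]
  have coords: "coordU m (u *\<^sub>R ?t + w *\<^sub>R ?s) = u" "coordW m (u *\<^sub>R ?t + w *\<^sub>R ?s) = w" for u w
    by (simp_all add: coord_linear coord_expanding_contracting[OF k])
  \<comment> \<open>The lines are cut into compact segments, so that their image in the torus is a
    countable union of compact sets and hence Borel.\<close>
  define A where "A = (\<lambda>c n. (\<lambda>v. c *\<^sub>R ?t + v *\<^sub>R ?s) ` {- real n..real n})"
  define B where "B = (\<lambda>c n. (\<lambda>v. v *\<^sub>R ?t + c *\<^sub>R ?s) ` {- real n..real n})"
  have E: "E = (\<Union>c\<in>ring. \<Union>n. A c n \<union> B c n)"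
  proof (intro set_eqI iffI)
    fix x assume "x \<in> E"
    obtain n where "max \<bar>coordU m x\<bar> \<bar>coordW m x\<bar> \<le> real n" using real_arch_simple by blast
    hence n: "\<bar>coordU m x\<bar> \<le> real n" "\<bar>coordW m x\<bar> \<le> real n" by auto
    from \<open>x \<in> E\<close> show "x \<in> (\<Union>c\<in>ring. \<Union>n. A c n \<union> B c n)"
      unfolding E_def mem_Collect_eq
    proof
      assume "coordU m x \<in> ring"
      moreover have "x \<in> A (coordU m x) n"
        unfolding A_def using decomp[of x] n by (intro image_eqI[of _ _ "coordW m x"]) auto
      ultimately show ?thesis by blast
    next
      assume "coordW m x \<in> ring"
      moreover have "x \<in> B (coordW m x) n"
        unfolding B_def using decomp[of x] n by (intro image_eqI[of _ _ "coordU m x"]) auto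
      ultimately show ?thesis by blast
    qed
  next
    fix x assume "x \<in> (\<Union>c\<in>ring. \<Union>n. A c n \<union> B c n)"
    thus "x \<in> E" by (auto simp: A_def B_def E_def coords)
  qed
  have "compact (A c n)" "compact (B c n)" for c n
    unfolding A_def B_def by (intro compact_continuous_image continuous_intros compact_Icc)+
  hence "closed (torus_proj ` A c n)" "closed (torus_proj ` B c n)" for c n
    by (intro compact_imp_closed compact_continuous_image continuous_on_subset[OF continuous_torus_proj] subset_UNIV; blast)+
  hence "(\<Union>c\<in>ring. \<Union>n. torus_proj ` A c n \<union> torus_proj ` B c n) \<in> sets borel"
    by (intro sets.countable_UN' countable_ring sets.countable_UN'' sets.Un borel_closed) auto
  also have "(\<Union>c\<in>ring. \<Union>n. torus_proj ` A c n \<union> torus_proj ` B c n) = torus_proj ` E"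
    unfolding E by blast
  finally have borel: "torus_proj ` E \<in> sets borel" .
  \<comment> \<open>Integer translations change the coordinates by elements of \<open>ring\<close>,
    so passing to the torus adds no points.\<close>
  have "torus_proj -` (torus_proj ` E) \<subseteq> E"
  proof
    fix x assume "x \<in> torus_proj -` (torus_proj ` E)"
    then obtain y where y: "y \<in> E" "torus_proj x = torus_proj y" by auto
    then obtain i j where "x - y = real_of_int i *\<^sub>R m + real_of_int j *\<^sub>R L m"
      using gen[of "x - y"] torus_proj_eq_iff by blast
    hence "coordU m x - coordU m y = real_of_int i + real_of_int j * \<beta>"
        "coordW m x - coordW m y = real_of_int i + real_of_int j * \<mu>"
      using coord_lattice[OF k] by (metis coord_linear(3,4))+
    hence "coordU m x = coordU m y + (real_of_int i + real_of_int j * \<beta>)"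
        "coordW m x = coordW m y + (real_of_int i + real_of_int j * \<mu>)" by simp_all
    hence "coordU m y \<in> ring \<Longrightarrow> coordU m x \<in> ring" "coordW m y \<in> ring \<Longrightarrow> coordW m x \<in> ring"
      by (simp_all only: ring_add ringI[OF refl] ring_mu)
    thus "x \<in> E" using y(1) unfolding E_def by blast
  qed
  moreover have "negligible E"
  proof -
    have "negligible {x. coordU m x = c}" "negligible {x. coordW m x = c}" for c
    proof -
      have nz: "vector [?s $ 2, - ?s $ 1] \<noteq> (0::real^2)" "vector [- ?t $ 2, ?t $ 1] \<noteq> (0::real^2)"
        using k by (auto simp: cross_def vec_eq_iff forall_2)
      have "coordU m x = vector [?s $ 2, - ?s $ 1] \<bullet> x / cross ?t ?s"
        "coordW m x = vector [- ?t $ 2, ?t $ 1] \<bullet> x / cross ?t ?s" for x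
        by (simp_all add: coordU_def coordW_def cross_def[of x] cross_def[of _ x] inner_vec_def sum_2 mult.commute)
      hence "{x. coordU m x = c} = {x. vector [?s $ 2, - ?s $ 1] \<bullet> x = c * cross ?t ?s}"
        "{x. coordW m x = c} = {x. vector [- ?t $ 2, ?t $ 1] \<bullet> x = c * cross ?t ?s}"
        using k by (simp_all only: divide_eq_eq not_False_eq_True if_True)
      thus "negligible {x. coordU m x = c}" "negligible {x. coordW m x = c}"
        using nz by (simp_all only: negligible_hyperplane simp_thms)
    qed
    hence "negligible (\<Union>c\<in>ring. {x. coordU m x = c} \<union> {x. coordW m x = c})"
      using countable_ring by (intro negligible_countable_Union) auto
    thus ?thesis by (rule negligible_subset) (auto simp: E_def)
  qed
  ultimately have "negligible (torus_proj -` (torus_proj ` E) \<inter> fundamental_domain)"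
    by (meson inf.coboundedI1 negligible_subset)
  hence null: "torus_proj ` E \<in> null_sets torus_lebesgue" using null_torus_iff[OF borel] by simp
  have "{p \<in> space torus_lebesgue. \<not> (\<forall>x. torus_proj x = p \<longrightarrow> coordU m x \<notin> ring \<and> coordW m x \<notin> ring)}
      \<subseteq> torus_proj ` E"
    unfolding E_def by blast
  thus ?thesis by (rule AE_I'[OF null])
qed

lemma exists_bijective_coding:
  assumes m: "intvec m" "expanding m \<noteq> 0"
    and gen: "\<And>z. intvec z \<Longrightarrow> \<exists>i j. z = real_of_int i *\<^sub>R m + real_of_int j *\<^sub>R L m"
  shows "\<exists>\<phi>. arithmetic_coding M \<phi> \<and> bijective_coding M \<phi>"
proof (intro exI conjI)
  let ?\<phi> = "\<lambda>\<epsilon>. torus_proj (coded_point m \<epsilon>)"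
  show "arithmetic_coding M ?\<phi>"
    unfolding arithmetic_coding_def using m homoclinic_expanding coding_limit by blast
  have unique: "\<exists>!\<epsilon>. \<epsilon> \<in> X \<and> ?\<phi> \<epsilon> = p"
    if good: "\<forall>x. torus_proj x = p \<longrightarrow> coordU m x \<notin> ring \<and> coordW m x \<notin> ring" for p
  proof -
    obtain x where x: "torus_proj x = p" by (metis Quotient_abs_rep Quotient_torus)
    obtain \<epsilon> i j where \<epsilon>: "\<epsilon> \<in> X" "coded_point m \<epsilon> - x = real_of_int i *\<^sub>R m + real_of_int j *\<^sub>R L m"
      using coding_onto[OF m] by blast
    have "intvec (coded_point m \<epsilon> - x)"
      unfolding \<epsilon>(2) using m by (intro intvec_add intvec_scale intvec_matrix)
    hence "?\<phi> \<epsilon> = p" using x by (simp add: torus_proj_eq_iff[symmetric])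
    thus ?thesis using coding_inject[OF m gen] good x \<epsilon>(1) by blast
  qed
  show "bijective_coding M ?\<phi>"
    unfolding bijective_coding_def by (rule eventually_mono[OF AE_generic[OF m gen] unique])
qed

text \<open>One uniquely coded point suffices. Its lifts \<open>x\<close> and \<open>x - z\<close>
  are both reached modulo the lattice of \<open>m\<close> and \<open>L m\<close>, necessarily by the
  same code, and the two lattice vectors subtract to \<open>z\<close>.\<close>

lemma bijective_coding_generates:
  assumes "arithmetic_coding M \<phi>" "bijective_coding M \<phi>"
  shows "\<exists>m. intvec m \<and> (\<forall>z. intvec z \<longrightarrow> (\<exists>i j. z = real_of_int i *\<^sub>R m + real_of_int j *\<^sub>R L m))"
proof -
  obtain t where t: "t \<noteq> 0" "homoclinic_coords M t" and lim: "\<And>\<epsilon>. \<epsilon> \<in> X \<Longrightarrow>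
      (\<lambda>N. torus_proj ((\<Sum>n=-int N..int N. real_of_int (\<epsilon> n) * \<beta> powi (-n)) *\<^sub>R t)) \<longlonglongrightarrow> \<phi> \<epsilon>"
    using assms(1) unfolding arithmetic_coding_def by blast
  obtain m where m: "intvec m" "t = expanding m" using homoclinic_is_expanding[OF t(2)] by blast
  have \<phi>: "\<phi> \<epsilon> = torus_proj (coded_point m \<epsilon>)" if "\<epsilon> \<in> X" for \<epsilon>
    using lim[OF that] coding_limit[OF that m(1)] unfolding m(2) by (rule LIMSEQ_unique)
  obtain p where p: "\<exists>!\<epsilon>. \<epsilon> \<in> X \<and> \<phi> \<epsilon> = p"
    using AE_torus_ex assms(2) unfolding bijective_coding_def by blast
  obtain x where x: "torus_proj x = p" by (metis Quotient_abs_rep Quotient_torus)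
  have onto: "\<exists>\<epsilon> i j. \<epsilon> \<in> X \<and> \<phi> \<epsilon> = torus_proj y \<and> coded_point m \<epsilon> - y = real_of_int i *\<^sub>R m + real_of_int j *\<^sub>R L m" for y
  proof -
    obtain \<epsilon> i j where \<epsilon>: "\<epsilon> \<in> X" "coded_point m \<epsilon> - y = real_of_int i *\<^sub>R m + real_of_int j *\<^sub>R L m"
      using coding_onto[of m y] m t(1) by blast
    have "intvec (coded_point m \<epsilon> - y)"
      unfolding \<epsilon>(2) using m by (intro intvec_add intvec_scale intvec_matrix)
    thus ?thesis using \<epsilon> \<phi> by (metis torus_proj_eq_iff)
  qed
  have gen: "\<exists>i j. z = real_of_int i *\<^sub>R m + real_of_int j *\<^sub>R L m" if z: "intvec z" for z
  proof -
    obtain \<epsilon> i j where \<epsilon>: "\<epsilon> \<in> X" "\<phi> \<epsilon> = torus_proj x"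
        "coded_point m \<epsilon> - x = real_of_int i *\<^sub>R m + real_of_int j *\<^sub>R L m"
      using onto by blast
    obtain \<epsilon>' i' j' where \<epsilon>': "\<epsilon>' \<in> X" "\<phi> \<epsilon>' = torus_proj (x - z)"
        "coded_point m \<epsilon>' - (x - z) = real_of_int i' *\<^sub>R m + real_of_int j' *\<^sub>R L m"
      using onto by blast
    have "torus_proj (x - z) = torus_proj x"
      using z intvec_diff[of 0 z] by (simp add: torus_proj_eq_iff)
    hence "\<epsilon>' = \<epsilon>" using p \<epsilon>(1,2) \<epsilon>'(1,2) x by auto
    hence "z = (coded_point m \<epsilon>' - (x - z)) - (coded_point m \<epsilon> - x)" by simp
    also have "\<dots> = real_of_int (i' - i) *\<^sub>R m + real_of_int (j' - j) *\<^sub>R L m"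
      unfolding \<epsilon>(3) \<epsilon>'(3) by (simp add: algebra_simps)
    finally show ?thesis by blast
  qed
  show ?thesis using m(1) gen by blast
qed

end

subsection \<open>Ergodicity forces hyperbolicity\<close>

text \<open>The function descends to the torus. Its superlevel set at the mean of two values is
  invariant, and it and the opposite sublevel set are nonempty and open, so neither is null.\<close>

lemma not_ergodic_invariant_function:
  fixes G :: "real^2 \<Rightarrow> real"
  assumes cont: "continuous_on UNIV G"
    and periodic: "\<And>x y. intvec (x - y) \<Longrightarrow> G x = G y"
    and invariant: "\<And>x. G (real_matrix M *v x) = G x"
    and nonconst: "G x0 < G y0"
  shows "\<not> ergodic torus_lebesgue (torus_map M)"
proof
  assume erg: "ergodic torus_lebesgue (torus_map M)"
  define c where "c = (G x0 + G y0) / 2"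
  define S S' where "S = torus_proj ` {x. c < G x}" "S' = torus_proj ` {x. G x < c}"
  note S = this
  have pre: "torus_proj -` S = {x. c < G x}" "torus_proj -` S' = {x. G x < c}"
    using periodic by (auto simp: S torus_proj_eq_iff)
  have "open {x. c < G x}" "open {x. G x < c}"
    using cont by (intro open_Collect_less continuous_on_const; simp)+
  hence op: "open S" "open S'" by (simp_all add: open_torus_def pre)
  have "c < G y0" "G x0 < c" using nonconst by (simp_all add: c_def)
  hence ne: "S \<noteq> {}" "S' \<noteq> {}" unfolding S by blast+
  have sets: "S \<in> sets torus_lebesgue" "space torus_lebesgue = UNIV" "S' \<in> sets torus_lebesgue"
    using op by (auto simp: torus_lebesgue_def)
  have "torus_map M -` S = S"
  proof (intro set_eqI)
    fix p
    obtain x where x: "p = torus_proj x" by (metis Quotient_abs_rep Quotient_torus)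
    have "torus_proj y \<in> S \<longleftrightarrow> c < G y" for y using pre(1) by blast
    thus "p \<in> torus_map M -` S \<longleftrightarrow> p \<in> S" by (simp add: x torus_map.abs_eq invariant)
  qed
  hence "emeasure torus_lebesgue S = 0 \<or> emeasure torus_lebesgue (UNIV - S) = 0"
    using erg sets unfolding ergodic_def by (metis inf_top.right_neutral)
  moreover have "S' \<subseteq> UNIV - S"
  proof
    fix p assume p: "p \<in> S'"
    obtain x where "p = torus_proj x" by (metis Quotient_abs_rep Quotient_torus)
    thus "p \<in> UNIV - S" using p pre by (metis (mono_tags, lifting) DiffI UNIV_I mem_Collect_eq not_less_iff_gr_or_eq vimageE vimageI)
  qed
  hence "emeasure torus_lebesgue S' \<le> emeasure torus_lebesgue (UNIV - S)"
    using sets.compl_sets[OF sets(1)] unfolding sets(2) by (intro emeasure_mono)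
  ultimately have "S \<in> null_sets torus_lebesgue \<or> S' \<in> null_sets torus_lebesgue"
    using sets by (auto simp: null_sets_def)
  thus False using open_torus_not_null op ne by blast
qed

lemma cos_2pi_cong: "u - v \<in> \<int> \<Longrightarrow> cos (2 * pi * u) = cos (2 * pi * v)"
  using cis_2pi_eq_iff[of u v] by (metis cis.sel(1))

lemma real_matrix_components:
  "(real_matrix M *v x) $ 1 = M $ 1 $ 1 * x $ 1 + M $ 1 $ 2 * x $ 2"
  "(real_matrix M *v x) $ 2 = M $ 2 $ 1 * x $ 1 + M $ 2 $ 2 * x $ 2"
  by (simp_all add: matrix_vector_mult_def real_matrix_def sum_2)

text \<open>The row (k, l) is fixed by M, so the character it defines is invariant; its real part is
  a nonconstant invariant function.\<close>

lemma not_ergodic_fixed_character: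
  fixes M :: "int^2^2" and k l :: int
  assumes "k * M $ 1 $ 1 + l * M $ 2 $ 1 = k" "k * M $ 1 $ 2 + l * M $ 2 $ 2 = l"
    and "k \<noteq> 0 \<or> l \<noteq> 0"
  shows "\<not> ergodic torus_lebesgue (torus_map M)"
proof -
  define G where "G = (\<lambda>x::real^2. cos (2 * pi * (k * x $ 1 + l * x $ 2)))"
  obtain x0 :: "real^2" where x0: "k * x0 $ 1 + l * x0 $ 2 = 1/2"
  proof (cases "k = 0")
    case True
    thus ?thesis using assms(3) that[of "vector [0, 1 / (2 * l)]"] by simp
  next
    case False
    thus ?thesis using that[of "vector [1 / (2 * k), 0]"] by simp
  qed
  have "G x0 = cos (2 * pi * (1/2))" unfolding G_def x0 ..
  hence "G x0 < G 0" by (simp add: G_def)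
  moreover have "continuous_on UNIV G" unfolding G_def by (intro continuous_intros)
  moreover have "G x = G y" if "intvec (x - y)" for x y
    unfolding G_def
  proof (rule cos_2pi_cong)
    have "k * x $ 1 + l * x $ 2 - (k * y $ 1 + l * y $ 2) = k * (x - y) $ 1 + l * (x - y) $ 2"
      by (simp add: algebra_simps)
    also have "\<dots> \<in> \<int>" using that unfolding intvec_def by (intro Ints_add Ints_mult) auto
    finally show "k * x $ 1 + l * x $ 2 - (k * y $ 1 + l * y $ 2) \<in> \<int>" .
  qed
  moreover have "G (real_matrix M *v x) = G x" for x
  proof -
    have "k * (real_matrix M *v x) $ 1 + l * (real_matrix M *v x) $ 2 =
        real_of_int (k * M $ 1 $ 1 + l * M $ 2 $ 1) * x $ 1 + real_of_int (k * M $ 1 $ 2 + l * M $ 2 $ 2) * x $ 2"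
      by (simp add: real_matrix_components algebra_simps)
    thus ?thesis unfolding G_def assms(1,2) by simp
  qed
  ultimately show ?thesis using not_ergodic_invariant_function by blast
qed

text \<open>Both eigenvalues are 1, so (M - 1)^2 = 0 and every row of M - 1 is fixed by M. If the
  first row vanishes the second is used, and if both vanish M is the identity and fixes every
  character.\<close>

lemma not_ergodic_trace_2:
  fixes M :: "int^2^2"
  assumes "det M = 1" "trace M = 2"
  shows "\<not> ergodic torus_lebesgue (torus_map M)"
proof -
  define a b c d where "a = M $ 1 $ 1" "b = M $ 1 $ 2" "c = M $ 2 $ 1" "d = M $ 2 $ 2"
  note abcd = this
  have d: "d = 2 - a" and "b * c = a * d - 1"
    using assms by (simp_all add: trace_def det_2 sum_2 abcd[symmetric])
  hence bc: "b * c = a * (2 - a) - 1" by simp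
  show ?thesis
  proof (cases "a = 1 \<and> b = 0")
    case False
    have "(a - 1) * a + b * c = a - 1" "(a - 1) * b + b * d = b"
      unfolding bc d by (simp_all add: algebra_simps)
    thus ?thesis
      using False not_ergodic_fixed_character[of "a - 1" M b] by (auto simp: abcd[symmetric])
  next
    case True
    show ?thesis
      using True d not_ergodic_fixed_character[of c M "d - 1"] not_ergodic_fixed_character[of 1 M 0]
        not_ergodic_fixed_character[of 0 M 1]
      by (auto simp: abcd[symmetric])
  qed
qed

text \<open>Here \<open>M\<^sup>3 = -1\<close>, so that the cosines of the first coordinates of \<open>x\<close>, \<open>M x\<close> and
  \<open>M\<^sup>2 x = M x - x\<close> are permuted by \<open>M\<close>.\<close>
lemma not_ergodic_trace_1:
  fixes M :: "int^2^2"
  assumes "det M = 1" "trace M = 1"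
  shows "\<not> ergodic torus_lebesgue (torus_map M)"
proof -
  define h where "h = (\<lambda>x. (real_matrix M *v x) $ 1)"
  define G where "G = (\<lambda>x. cos (2 * pi * x $ 1) + cos (2 * pi * h x) + cos (2 * pi * (h x - x $ 1)))"
  have "real_of_int (trace M) = 1" "real_of_int (det M) = 1" using assms by simp_all
  hence tr: "real_of_int (M $ 2 $ 2) = 1 - M $ 1 $ 1"
    and "M $ 1 $ 2 * real_of_int (M $ 2 $ 1) = M $ 1 $ 1 * real_of_int (M $ 2 $ 2) - 1"
    by (simp_all add: trace_def det_2 sum_2)
  hence dt: "M $ 1 $ 2 * real_of_int (M $ 2 $ 1) = M $ 1 $ 1 * (1 - real_of_int (M $ 1 $ 1)) - 1"
    by simp
  have h2: "h (real_matrix M *v x) = h x - x $ 1" for x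
  proof -
    have "h (real_matrix M *v x) = (M $ 1 $ 1 * real_of_int (M $ 1 $ 1) + M $ 1 $ 2 * real_of_int (M $ 2 $ 1)) * x $ 1
        + M $ 1 $ 2 * (M $ 1 $ 1 + real_of_int (M $ 2 $ 2)) * x $ 2"
      unfolding h_def real_matrix_components by (simp add: algebra_simps)
    thus ?thesis unfolding tr dt h_def real_matrix_components by (simp add: algebra_simps)
  qed
  have "G (real_matrix M *v x) = G x" for x
  proof -
    have "G (real_matrix M *v x) = cos (2 * pi * h x) + cos (2 * pi * (h x - x $ 1)) + cos (- (2 * pi * x $ 1))"
      unfolding G_def h2 by (simp add: h_def)
    thus ?thesis by (simp add: G_def)
  qed
  moreover have "continuous_on UNIV G"
    unfolding G_def h_def real_matrix_components by (intro continuous_intros)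
  moreover have "G x = G y" if "intvec (x - y)" for x y
  proof -
    have 1: "x $ 1 - y $ 1 \<in> \<int>" using that by (auto simp: intvec_def)
    have "h x - h y \<in> \<int>"
      using intvec_matrix[OF that, of M] by (auto simp: intvec_def h_def matrix_vector_mult_diff_distrib)
    moreover from Ints_diff[OF this 1] have "h x - x $ 1 - (h y - y $ 1) \<in> \<int>" by (simp add: algebra_simps)
    ultimately show ?thesis unfolding G_def using 1 by (metis cos_2pi_cong)
  qed
  \<comment> \<open>At the origin all three cosines are 1; at the other point the first one is
    -1.\<close>
  moreover have "G (vector [1/2, 0]) < G 0"
  proof -
    have "G 0 = 3" by (simp add: G_def h_def)
    moreover have "cos (2 * pi * (vector [1/2, 0] :: real^2) $ 1) = -1" by simp
    hence "G (vector [1/2, 0]) \<le> -1 + 1 + 1" unfolding G_def by (intro add_mono cos_le_one) simp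
    ultimately show ?thesis by simp
  qed
  ultimately show ?thesis using not_ergodic_invariant_function by blast
qed

subsection \<open>Integer two by two matrices\<close>

lemma det_unit_if_invertible:
  fixes B :: "int^2^2"
  assumes "invertible B" shows "det B = 1 \<or> det B = -1"
proof -
  obtain A where "B ** A = mat 1" using assms by (auto simp: invertible_def)
  hence "det B * det A = 1" by (metis det_I det_mul)
  thus ?thesis by (auto simp: zmult_eq_1_iff)
qed

definition adjugate :: "int^2^2 \<Rightarrow> int^2^2" where
  "adjugate B = vector [vector [B $ 2 $ 2, - B $ 1 $ 2], vector [- B $ 2 $ 1, B $ 1 $ 1]]"

lemma inverse_adjugate:
  fixes B :: "int^2^2"
  assumes "det B = 1 \<or> det B = -1"
  shows "B ** (\<chi> i j. det B * adjugate B $ i $ j) = mat 1" "(\<chi> i j. det B * adjugate B $ i $ j) ** B = mat 1"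
proof -
  have "det B * det B = 1" using assms by auto
  hence *: "det B * (B $ 1 $ 1 * B $ 2 $ 2 - B $ 1 $ 2 * B $ 2 $ 1) = 1" by (simp add: det_2)
  show "B ** (\<chi> i j. det B * adjugate B $ i $ j) = mat 1" "(\<chi> i j. det B * adjugate B $ i $ j) ** B = mat 1"
    using * by (simp_all add: vec_eq_iff forall_2 matrix_matrix_mult_def sum_2 mat_def adjugate_def)
      (simp_all add: algebra_simps)
qed

text \<open>\<open>matrix_inv\<close> is a choice of a two-sided inverse, so uniqueness of inverses
  identifies it with the explicit one.\<close>

lemma matrix_inv_adjugate:
  fixes B :: "int^2^2"
  assumes "det B = 1 \<or> det B = -1"
  shows "matrix_inv B = (\<chi> i j. det B * adjugate B $ i $ j)"
proof -
  let ?A = "\<chi> i j. det B * adjugate B $ i $ j"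
  have "matrix_inv B ** B = mat 1"
    unfolding matrix_inv_def using someI[of "\<lambda>A. B ** A = mat 1 \<and> A ** B = mat 1" ?A]
      inverse_adjugate[OF assms] by blast
  hence "matrix_inv B = matrix_inv B ** (B ** ?A)" using inverse_adjugate[OF assms] by simp
  also have "\<dots> = ?A" using \<open>matrix_inv B ** B = mat 1\<close> by (simp add: matrix_mul_assoc)
  finally show ?thesis .
qed

lemma invertible_iff_det_unit:
  fixes B :: "int^2^2"
  shows "invertible B \<longleftrightarrow> det B = 1 \<or> det B = -1"
  using det_unit_if_invertible inverse_adjugate unfolding invertible_def by blast

lemma conjugates_iff:
  fixes B M C :: "int^2^2"
  assumes "invertible B"
  shows "B ** M ** matrix_inv B = C \<longleftrightarrow> B ** M = C ** B"
proof -
  have "B ** matrix_inv B = mat 1" "matrix_inv B ** B = mat 1"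
    using matrix_inv_adjugate inverse_adjugate assms invertible_iff_det_unit by auto
  thus ?thesis by (metis matrix_mul_assoc matrix_mul_rid)
qed

definition companion_rows :: "int^2^2 \<Rightarrow> int^2^2 \<Rightarrow> bool" where
  "companion_rows M B \<longleftrightarrow> B $ 2 $ 1 = B $ 1 $ 2 * M $ 2 $ 1 - B $ 1 $ 1 * M $ 2 $ 2 \<and>
     B $ 2 $ 2 = B $ 1 $ 1 * M $ 1 $ 2 - B $ 1 $ 2 * M $ 1 $ 1"

text \<open>The first row of the equation says that the second row of B is (x, y)(M - r), where (x,
  y) is its first row; the second row of the equation is then Cayley-Hamilton.\<close>

lemma intertwines_iff:
  "B ** M = companion_matrix (trace M) (det M) ** B \<longleftrightarrow> companion_rows M B"
proof
  assume "B ** M = companion_matrix (trace M) (det M) ** B"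
  thus "companion_rows M B"
    by (simp add: vec_eq_iff forall_2 matrix_matrix_mult_def sum_2 companion_matrix_def
      companion_rows_def trace_def algebra_simps)
next
  assume *: "companion_rows M B"
  note rows = conjunct1[OF *[unfolded companion_rows_def]] conjunct2[OF *[unfolded companion_rows_def]]
  show "B ** M = companion_matrix (trace M) (det M) ** B"
    by (simp add: rows vec_eq_iff forall_2 matrix_matrix_mult_def sum_2 companion_matrix_def
       trace_def det_2 algebra_simps)
qed

lemma det_companion_rows:
  assumes "companion_rows M B" shows "det B = assoc_form M (B $ 1 $ 1) (B $ 1 $ 2)"
proof -
  note rows = conjunct1[OF assms[unfolded companion_rows_def]] conjunct2[OF assms[unfolded companion_rows_def]]
  show ?thesis
    by (simp add: rows det_2 assoc_form_def power2_eq_square algebra_simps)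
qed

text \<open>By Cayley-Hamilton, minus the determinant times the inverse of M equals M - r.\<close>

lemma second_row_iff:
  fixes M B :: "int^2^2"
  assumes "invertible M"
  shows "B $ 2 = - det M *s (B $ 1 v* matrix_inv M) \<longleftrightarrow> companion_rows M B"
proof -
  have "det M * det M = 1" "det M = 1 \<or> det M = -1" using assms invertible_iff_det_unit by auto
  hence "- det M *s (B $ 1 v* matrix_inv M) =
      vector [B $ 1 $ 2 * M $ 2 $ 1 - B $ 1 $ 1 * M $ 2 $ 2, B $ 1 $ 1 * M $ 1 $ 2 - B $ 1 $ 2 * M $ 1 $ 1]"
    by (auto simp: vec_eq_iff forall_2 matrix_inv_adjugate vector_matrix_mult_def sum_2 adjugate_def algebra_simps)
  thus ?thesis by (simp add: vec_eq_iff forall_2 companion_rows_def)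
qed

lemma conjugation_parametrized:
  fixes M B :: "int^2^2"
  assumes "invertible M"
  shows "invertible B \<and> B ** M ** matrix_inv B = companion_matrix (trace M) (det M) \<longleftrightarrow>
     (assoc_form M (B $ 1 $ 1) (B $ 1 $ 2) = 1 \<or> assoc_form M (B $ 1 $ 1) (B $ 1 $ 2) = -1) \<and>
     B $ 2 = - det M *s (B $ 1 v* matrix_inv M)"
  using conjugates_iff[of B] intertwines_iff[of B M] det_companion_rows[of M B] second_row_iff[OF assms, of B]
    invertible_iff_det_unit[of B] by metis

lemma conjugate_iff_form_unit:
  fixes M :: "int^2^2"
  assumes "invertible M"
  shows "algebraically_conjugate M (companion_matrix (trace M) (det M)) \<longleftrightarrow>
    (\<exists>x y. assoc_form M x y = 1 \<or> assoc_form M x y = -1)"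
proof
  assume "\<exists>x y. assoc_form M x y = 1 \<or> assoc_form M x y = -1"
  then obtain x y where xy: "assoc_form M x y = 1 \<or> assoc_form M x y = -1" by blast
  define w where "w = - det M *s (vector [x, y] v* matrix_inv M)"
  have "(vector [vector [x, y], w] :: int^2^2) $ 1 = vector [x, y]" "(vector [vector [x, y], w] :: int^2^2) $ 2 = w"
    by simp_all
  thus "algebraically_conjugate M (companion_matrix (trace M) (det M))"
    unfolding algebraically_conjugate_def conjugation_parametrized[OF assms]
    using xy by (intro exI[of _ "vector [vector [x, y], w]"]) (simp add: w_def)
qed (auto simp: algebraically_conjugate_def conjugation_parametrized[OF assms])

subsection \<open>Bijective codings and the associated form\<close>

text \<open>With determinant 1, ergodicity excludes the traces 1 and 2 by the invariant functions
  above; the remaining requirements follow from the quadratic formula.\<close>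

lemma torus_automorphism_if_ergodic:
  fixes M :: "int^2^2"
  assumes "invertible M" "ergodic torus_lebesgue (torus_map M)" "trace M > 0"
  shows "torus_automorphism M (trace M - dominant_eigenvalue M)"
proof
  let ?r = "real_of_int (trace M)" and ?\<sigma> = "real_of_int (det M)" and ?\<beta> = "dominant_eigenvalue M"
  show cases: "det M = -1 \<and> trace M \<ge> 1 \<or> det M = 1 \<and> trace M \<ge> 3"
  proof (cases "det M = 1")
    case True
    hence "trace M \<noteq> 1" "trace M \<noteq> 2"
      using not_ergodic_trace_1 not_ergodic_trace_2 assms(2) by blast+
    thus ?thesis using True assms(3) by linarith
  next
    case False
    thus ?thesis using det_unit_if_invertible[OF assms(1)] assms(3) by simp
  qed
  define D where "D = ?r\<^sup>2 - 4 * ?\<sigma>"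
  have \<beta>: "?\<beta> = (?r + sqrt D) / 2" by (simp add: dominant_eigenvalue_def D_def Let_def)
  have r: "?r \<ge> 1" "?r\<^sup>2 \<ge> 1" using assms(3) by simp_all
  have D: "D > 0 \<and> ?r + sqrt D > 2"
  proof (cases "det M = -1")
    case True
    hence "D > 2\<^sup>2" using r by (simp add: D_def)
    hence "sqrt D > 2" by (rule real_less_rsqrt)
    thus ?thesis using \<open>D > 2\<^sup>2\<close> r by simp
  next
    case False
    hence "det M = 1" "?r \<ge> 3" using cases by auto
    moreover have "?r\<^sup>2 \<ge> 3\<^sup>2" using \<open>?r \<ge> 3\<close> by (intro power_mono) auto
    ultimately have "D > 0" by (simp add: D_def)
    thus ?thesis using \<open>?r \<ge> 3\<close> by (smt (verit) real_sqrt_gt_zero)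
  qed
  thus "1 < ?\<beta>" by (simp add: \<beta>)
  show "?\<beta> + (?r - ?\<beta>) = ?r" by simp
  have "?\<beta> * (?r - ?\<beta>) = (?r\<^sup>2 - (sqrt D)\<^sup>2) / 4"
    unfolding \<beta> by (simp add: power2_eq_square field_simps)
  also have "\<dots> = ?\<sigma>" using D by (simp add: D_def)
  finally show "?\<beta> * (?r - ?\<beta>) = ?\<sigma>" .
qed

context torus_automorphism
begin

text \<open>The form takes row vectors and the lattice consists of column vectors; a quarter turn
  relates the two.\<close>

lemma cross_L:
  assumes "m $ 1 = real_of_int p" "m $ 2 = real_of_int q"
  shows "cross m (L m) = - real_of_int (assoc_form M q (- p))"
  using assms by (simp add: cross_def real_matrix_components assoc_form_def power2_eq_square algebra_simps)

text \<open>Both sides say that \<open>m\<close> and \<open>L m\<close> form a basis of the integer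
  lattice for some integer \<open>m\<close>, that is, have determinant 1 or -1.\<close>

lemma bijective_coding_iff:
  "(\<exists>\<phi>. arithmetic_coding M \<phi> \<and> bijective_coding M \<phi>) \<longleftrightarrow>
   (\<exists>x y. assoc_form M x y = 1 \<or> assoc_form M x y = -1)"
proof
  assume "\<exists>\<phi>. arithmetic_coding M \<phi> \<and> bijective_coding M \<phi>"
  then obtain m where m: "intvec m"
    and gen: "\<And>z. intvec z \<Longrightarrow> \<exists>i j. z = real_of_int i *\<^sub>R m + real_of_int j *\<^sub>R L m"
    using bijective_coding_generates by metis
  obtain p q where pq: "m $ 1 = real_of_int p" "m $ 2 = real_of_int q"
    using m by (auto simp: intvec_def elim!: Ints_cases) (metis Ints_cases)
  have "intvec (vector [1, 0])" "intvec (vector [0, 1])" by (simp_all add: intvec_def forall_2)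
  then obtain i j i' j' where ij: "vector [1, 0] = real_of_int i *\<^sub>R m + real_of_int j *\<^sub>R L m"
      "vector [0, 1] = real_of_int i' *\<^sub>R m + real_of_int j' *\<^sub>R L m"
    using gen by metis
  \<comment> \<open>Determinants are multiplicative: that of \<open>m\<close> and \<open>L m\<close>
    divides 1.\<close>
  have "1 = cross (vector [1, 0]) (vector [0, 1])" by (simp add: cross_def)
  also have "\<dots> = (i * j' - j * i') * cross m (L m)"
    unfolding ij using cross_antisym[of m "L m"] by (simp add: algebra_simps)
  also have "\<dots> = real_of_int ((j * i' - i * j') * assoc_form M q (- p))"
    unfolding cross_L[OF pq] by (simp add: algebra_simps)
  finally have "(j * i' - i * j') * assoc_form M q (- p) = 1" by (metis of_int_eq_1_iff)
  thus "\<exists>x y. assoc_form M x y = 1 \<or> assoc_form M x y = -1"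
    by (auto simp: zmult_eq_1_iff)
next
  assume "\<exists>x y. assoc_form M x y = 1 \<or> assoc_form M x y = -1"
  then obtain x y where xy: "assoc_form M x y = 1 \<or> assoc_form M x y = -1" by blast
  \<comment> \<open>The inverse quarter turn, so that \<open>cross_L\<close> returns the form at (x,
    y).\<close>
  define m :: "real^2" where "m = vector [real_of_int (- y), real_of_int x]"
  have m: "intvec m" by (simp add: m_def intvec_def forall_2)
  define k where "k = assoc_form M x y"
  have k: "cross m (L m) = - real_of_int k" "k * k = 1"
    using cross_L[of m "- y" x] xy by (auto simp: m_def k_def)
  have "expanding m \<noteq> 0"
  proof
    assume "expanding m = 0"
    hence "L m = \<mu> *\<^sub>R m" using mu_less_beta by (simp add: expanding_def)
    hence "cross m (L m) = 0" by simp
    thus False using k by simp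
  qed
  have "\<exists>i j. z = real_of_int i *\<^sub>R m + real_of_int j *\<^sub>R L m" if z: "intvec z" for z
  proof -
    have int_cross: "cross u v \<in> \<int>" if "intvec u" "intvec v" for u v
      using that unfolding cross_def intvec_def by (intro Ints_diff Ints_mult) auto
    obtain i j where ij: "cross z (L m) = real_of_int i" "cross m z = real_of_int j"
      using int_cross[of z "L m"] int_cross[of m z] z m intvec_matrix by (metis Ints_cases)
    \<comment> \<open>Cramer's rule with determinant \<open>- k\<close>; since
      \<open>k * k = 1\<close>, multiplying by \<open>- k\<close> again clears it without leaving
      the integers.\<close>
    have "(- real_of_int k) *\<^sub>R ((- real_of_int k) *\<^sub>R z) = (- real_of_int k) *\<^sub>R (real_of_int i *\<^sub>R m + real_of_int j *\<^sub>R L m)"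
      using cross_decompose[of m "L m" z] unfolding k(1) ij by simp
    moreover have "real_of_int k * k = 1" using k(2) by (metis of_int_1 of_int_mult)
    ultimately have "z = real_of_int (- k * i) *\<^sub>R m + real_of_int (- k * j) *\<^sub>R L m"
      by (simp add: scaleR_add_right)
    thus ?thesis by blast
  qed
  thus "\<exists>\<phi>. arithmetic_coding M \<phi> \<and> bijective_coding M \<phi>"
    by (rule exists_bijective_coding[OF m \<open>expanding m \<noteq> 0\<close>])
qed

end

theorem theorem2p5:
  fixes M :: "int^2^2" and r \<sigma> :: int
  assumes "invertible M"
    and "ergodic torus_lebesgue (torus_map M)"
    and "r = trace M" and "r > 0" and "\<sigma> = det M"
  shows "((\<exists>\<phi>. arithmetic_coding M \<phi> \<and> bijective_coding M \<phi>) \<longleftrightarrow>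
            algebraically_conjugate M (companion_matrix r \<sigma>)) \<and>
         (algebraically_conjugate M (companion_matrix r \<sigma>) \<longleftrightarrow>
            (\<exists>x y. assoc_form M x y = 1 \<or> assoc_form M x y = -1)) \<and>
         (\<forall>B :: int^2^2.
            invertible B \<and> B ** M ** matrix_inv B = companion_matrix r \<sigma> \<longleftrightarrow>
              (assoc_form M (B $ 1 $ 1) (B $ 1 $ 2) = 1 \<or>
               assoc_form M (B $ 1 $ 1) (B $ 1 $ 2) = -1) \<and>
              B $ 2 = - det M *s (B $ 1 v* matrix_inv M))"
proof -
  interpret torus_automorphism M "trace M - dominant_eigenvalue M"
    using torus_automorphism_if_ergodic assms by blast
  show ?thesis
    using bijective_coding_iff conjugate_iff_form_unit[OF assms(1)] conjugation_parametrized[OF assms(1)]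
    unfolding assms(3,5) by blast
qed

end
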